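(* Let $A$ be a $\Bbbk$-algebra, let $n\geq 1$ be an integer, and let $\{\!\{-,-\}\!\}:A\times A\to A\otimes A$ be a double $[(12),(13)]$-weak Poisson bracket associated with the left bimodule structure. Then the unique antisymmetric biderivation $\{-,-\}$ on $\Bbbk[\operatorname{Rep}(A,n)]$ satisfying $$\{a_{ij},b_{kl}\}=\{\!\{a,b\}\!\}'_{kl}\,\{\!\{a,b\}\!\}''_{ij}\,,\qquad a,b\in A,\ 1\leq i,j,k,l\leq n,$$ is a Poisson bracket. Furthermore, this Poisson bracket descends (i.e. restricts) to the ring of trace functions $\Bbbk[\operatorname{Rep}(A,n)]^{\operatorname{tr}}$.
   Context: $\Bbbk$ is a field of characteristic $0$, $\otimes=\otimes_\Bbbk$, and all algebras are unital, associative, finitely generated $\Bbbk$-algebras. An element $d\in A\otimes A$ is written $d=d'\otimes d''$ (Sweedler notation, sum suppressed), and $d^\circ=d''\otimes d'$. The symmetric group $S_m$ acts on $A^{\otimes m}$ by $\tau_\sigma(a_1\otimes\cdots\otimes a_m)=a_{\sigma^{-1}(1)}\otimes\cdots\otimes a_{\sigma^{-1}(m)}$. A double bracket on $A$ associated with the left bimodule structure is a $\Bbbk$-bilinear map $\{\!\{-,-\}\!\}:A\times A\to A\otimes A$ such that for all $a,b,c\in A$: $\{\!\{a,b\}\!\}=-\{\!\{b,a\}\!\}^\circ$; $\{\!\{a,bc\}\!\}=b\{\!\{a,c\}\!\}'\otimes\{\!\{a,c\}\!\}''+\{\!\{a,b\}\!\}'c\otimes\{\!\{a,b\}\!\}''$;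 $\{\!\{bc,a\}\!\}=\{\!\{c,a\}\!\}'\otimes b\{\!\{c,a\}\!\}''+\{\!\{b,a\}\!\}'\otimes\{\!\{b,a\}\!\}''c$. Put $\{\!\{a,b_1\otimes b_2\}\!\}_L=\{\!\{a,b_1\}\!\}\otimes b_2\in A^{\otimes 3}$ (extended linearly). The double Jacobiator is $\{\!\{a,b,c\}\!\}=\{\!\{a,\{\!\{b,c\}\!\}\}\!\}_L+\tau_{(123)}\{\!\{b,\{\!\{c,a\}\!\}\}\!\}_L+\tau_{(132)}\{\!\{c,\{\!\{a,b\}\!\}\}\!\}_L$. The double bracket is $[(12),(13)]$-weak Poisson if the $[(12),(13)]$-weak double Jacobiator $\{\!\{a,b,c\}\!\}-\tau_{(12)}\{\!\{c,b,a\}\!\}$ vanishes for all $a,b,c\in A$. $\Bbbk[\operatorname{Rep}(A,n)]$ is the commutative $\Bbbk$-algebra generated by symbols $a_{ij}$ ($a\in A$, $1\leq i,j\leq n$) subject to $\lambda a_{ij}+\mu b_{ij}=(\lambda a+\mu b)_{ij}$, $1_{ij}=\delta_{ij}$, $(ab)_{ij}=\sum_{k=1}^n a_{ik}b_{kj}$ for $a,b\in A$, $\lambda,\mu\in\Bbbk$. For $a \in A$, $\mathtt{X}(a)=(a_{ij})_{i,j}$ is the matrix with entries $a_{ij}$, and $\Bbbk[\operatorname{Rep}(A,n)]^{\operatorname{tr}}$ is the subalgebra generated by $\operatorname{tr}\mathtt{X}(a)=\sum_i a_{ii}$, $a\in A$. It is known that the antisymmetric biderivation in the statement exists and is unique for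 any double bracket associated with the left bimodule structure. *)

theory Defs
  imports
    "HOL-Library.Poly_Mapping"
    "HOL-Algebra.QuotRing"
    "HOL-Algebra.Module"
    "HOL-Algebra.Subrings"
    "HOL-Combinatorics.Permutations"
    "HOL-Combinatorics.Cycles"
begin

text \<open>
  The input algebra is a type; the sort \<open>{ring, monoid_mult}\<close> is that of unital associative
  rings without the requirement \<open>0 \<noteq> 1\<close>, so that the zero algebra is included.  The objects
  built from it (tensor powers, the coordinate ring of the representation scheme) are
  quotients depending on the scalar multiplication, hence are given by explicit carriers.
\<close>

locale assoc_algebra = vector_space scale
  for scale :: "'k::field \<Rightarrow> 'a::{ring, monoid_mult} \<Rightarrow> 'a" +
  assumes scale_mult_left: "scale c x * y = scale c (x * y)"
    and scale_mult_right: "x * scale c y = scale c (x * y)"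

definition finitely_generated_algebra ::
    "('k::field \<Rightarrow> 'a::{ring, monoid_mult} \<Rightarrow> 'a) \<Rightarrow> bool" where
  "finitely_generated_algebra scale \<longleftrightarrow>
     (\<exists>S. finite S \<and>
        (\<lambda>V. Modules.module.subspace scale V \<and> 1 \<in> V \<and> (\<forall>x\<in>V. \<forall>y\<in>V. x * y \<in> V)) hull S = UNIV)"

definition scalars :: "'k::field ring" where
  "scalars = \<lparr>carrier = UNIV, monoid.mult = (*), one = 1, zero = 0, add = (+)\<rparr>"


section \<open>Tensor powers\<close>

text \<open>
  The \<open>m\<close>-th tensor power is the vector space of formal linear combinations of lists of
  length \<open>m\<close>, modulo the relations expressing linearity in each entry.
\<close>

definition formal_scale :: "'k::field \<Rightarrow> ('b \<Rightarrow>\<^sub>0 'k) \<Rightarrow> ('b \<Rightarrow>\<^sub>0 'k)" where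
  "formal_scale c p = Poly_Mapping.map (\<lambda>x. c * x) p"

definition multilinear_relations ::
    "('k::field \<Rightarrow> 'a::{ring, monoid_mult} \<Rightarrow> 'a) \<Rightarrow> nat \<Rightarrow> ('a list \<Rightarrow>\<^sub>0 'k) set" where
  "multilinear_relations scale m =
     {Poly_Mapping.single (xs[i := u + v]) 1
        - Poly_Mapping.single (xs[i := u]) 1 - Poly_Mapping.single (xs[i := v]) 1
      | xs i u v. length xs = m \<and> i < m}
   \<union> {Poly_Mapping.single (xs[i := scale c u]) 1 - Poly_Mapping.single (xs[i := u]) c
      | xs i c u. length xs = m \<and> i < m}"

definition tensor_class ::
    "('k::field \<Rightarrow> 'a::{ring, monoid_mult} \<Rightarrow> 'a) \<Rightarrow> nat \<Rightarrow> ('a list \<Rightarrow>\<^sub>0 'k) \<Rightarrow> ('a list \<Rightarrow>\<^sub>0 'k) set"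
  where
  "tensor_class scale m p =
     {q. q - p \<in> Modules.module.span formal_scale (multilinear_relations scale m)}"

text \<open>Only the vector space structure is used; the ring fields of the record are irrelevant.\<close>

definition tensor_power ::
    "('k::field \<Rightarrow> 'a::{ring, monoid_mult} \<Rightarrow> 'a) \<Rightarrow> nat \<Rightarrow> ('k, ('a list \<Rightarrow>\<^sub>0 'k) set) module"
  where
  "tensor_power scale m =
     \<lparr>carrier = tensor_class scale m ` {p. \<forall>xs \<in> Poly_Mapping.keys p. length xs = m},
      monoid.mult = undefined, one = undefined,
      zero = tensor_class scale m 0,
      add = (\<lambda>X Y. \<Union>p\<in>X. \<Union>q\<in>Y. tensor_class scale m (p + q)),
      smult = (\<lambda>c X. \<Union>p\<in>X. tensor_class scale m (formal_scale c p))\<rparr>"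

definition pure_tensor ::
    "('k::field \<Rightarrow> 'a::{ring, monoid_mult} \<Rightarrow> 'a) \<Rightarrow> 'a list \<Rightarrow> ('a list \<Rightarrow>\<^sub>0 'k) set" where
  "pure_tensor scale xs = tensor_class scale (length xs) (Poly_Mapping.single xs 1)"

text \<open>
  \<open>tensor_lift V f\<close> is the linear map into \<open>V\<close> that sends the pure tensor of \<open>xs\<close> to \<open>f xs\<close>.
  The chosen representative does not matter, as \<open>f\<close> is multilinear in all uses below.
  In Sweedler notation, \<open>tensor_lift V (\<lambda>xs. f (xs ! 0) (xs ! 1)) d\<close> is \<open>f(d', d'')\<close>.
\<close>

definition tensor_lift ::
    "('k::field, 'v, 'z) module_scheme \<Rightarrow> ('a list \<Rightarrow> 'v) \<Rightarrow> ('a list \<Rightarrow>\<^sub>0 'k) set \<Rightarrow> 'v" where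
  "tensor_lift V f d =
     (let p = (SOME p. p \<in> d)
      in finsum V (\<lambda>xs. Poly_Mapping.lookup p xs \<odot>\<^bsub>V\<^esub> f xs) (Poly_Mapping.keys p))"

text \<open>Positions in a list are counted from \<open>0\<close>, so \<open>\<sigma>\<close> permutes \<open>{0, \<dots>, m - 1}\<close>.\<close>

definition tensor_permute ::
    "('k::field \<Rightarrow> 'a::{ring, monoid_mult} \<Rightarrow> 'a) \<Rightarrow> nat \<Rightarrow> (nat \<Rightarrow> nat)
     \<Rightarrow> ('a list \<Rightarrow>\<^sub>0 'k) set \<Rightarrow> ('a list \<Rightarrow>\<^sub>0 'k) set" where
  "tensor_permute scale m \<sigma> =
     tensor_lift (tensor_power scale m) (\<lambda>xs. pure_tensor scale (permute_list (inv_into UNIV \<sigma>) xs))"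

definition tensor_opposite ::
    "('k::field \<Rightarrow> 'a::{ring, monoid_mult} \<Rightarrow> 'a) \<Rightarrow> ('a list \<Rightarrow>\<^sub>0 'k) set \<Rightarrow> ('a list \<Rightarrow>\<^sub>0 'k) set"
  where
  "tensor_opposite scale =
     tensor_lift (tensor_power scale 2) (\<lambda>xs. pure_tensor scale [xs ! 1, xs ! 0])"

definition tensor_append ::
    "('k::field \<Rightarrow> 'a::{ring, monoid_mult} \<Rightarrow> 'a) \<Rightarrow> ('a list \<Rightarrow>\<^sub>0 'k) set \<Rightarrow> 'a
     \<Rightarrow> ('a list \<Rightarrow>\<^sub>0 'k) set" where
  "tensor_append scale d y =
     tensor_lift (tensor_power scale 3) (\<lambda>xs. pure_tensor scale [xs ! 0, xs ! 1, y]) d"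


section \<open>Double brackets\<close>

locale double_bracket = assoc_algebra scale
  for scale :: "'k::field \<Rightarrow> 'a::{ring, monoid_mult} \<Rightarrow> 'a"
  and db :: "'a \<Rightarrow> 'a \<Rightarrow> ('a list \<Rightarrow>\<^sub>0 'k) set" +
  assumes db_closed: "db a b \<in> carrier (tensor_power scale 2)"
    and db_add_left: "db (a + b) c = db a c \<oplus>\<^bsub>tensor_power scale 2\<^esub> db b c"
    and db_add_right: "db a (b + c) = db a b \<oplus>\<^bsub>tensor_power scale 2\<^esub> db a c"
    and db_scale_left: "db (scale r a) b = r \<odot>\<^bsub>tensor_power scale 2\<^esub> db a b"
    and db_scale_right: "db a (scale r b) = r \<odot>\<^bsub>tensor_power scale 2\<^esub> db a b"
    and db_antisym: "db a b = \<ominus>\<^bsub>tensor_power scale 2\<^esub> tensor_opposite scale (db b a)"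
    and db_mult_right:
      "db a (b * c) =
         tensor_lift (tensor_power scale 2) (\<lambda>xs. pure_tensor scale [b * xs ! 0, xs ! 1]) (db a c)
         \<oplus>\<^bsub>tensor_power scale 2\<^esub>
         tensor_lift (tensor_power scale 2) (\<lambda>xs. pure_tensor scale [xs ! 0 * c, xs ! 1]) (db a b)"
    and db_mult_left:
      "db (b * c) a =
         tensor_lift (tensor_power scale 2) (\<lambda>xs. pure_tensor scale [xs ! 0, b * xs ! 1]) (db c a)
         \<oplus>\<^bsub>tensor_power scale 2\<^esub>
         tensor_lift (tensor_power scale 2) (\<lambda>xs. pure_tensor scale [xs ! 0, xs ! 1 * c]) (db b a)"

definition bracket_L ::
    "('k::field \<Rightarrow> 'a::{ring, monoid_mult} \<Rightarrow> 'a) \<Rightarrow> ('a \<Rightarrow> 'a \<Rightarrow> ('a list \<Rightarrow>\<^sub>0 'k) set)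
     \<Rightarrow> 'a \<Rightarrow> ('a list \<Rightarrow>\<^sub>0 'k) set \<Rightarrow> ('a list \<Rightarrow>\<^sub>0 'k) set" where
  "bracket_L scale db a =
     tensor_lift (tensor_power scale 3) (\<lambda>xs. tensor_append scale (db a (xs ! 0)) (xs ! 1))"

definition double_jacobiator ::
    "('k::field \<Rightarrow> 'a::{ring, monoid_mult} \<Rightarrow> 'a) \<Rightarrow> ('a \<Rightarrow> 'a \<Rightarrow> ('a list \<Rightarrow>\<^sub>0 'k) set)
     \<Rightarrow> 'a \<Rightarrow> 'a \<Rightarrow> 'a \<Rightarrow> ('a list \<Rightarrow>\<^sub>0 'k) set" where
  "double_jacobiator scale db a b c =
     bracket_L scale db a (db b c)
     \<oplus>\<^bsub>tensor_power scale 3\<^esub>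
     tensor_permute scale 3 (cycle_of_list [0, 1, 2]) (bracket_L scale db b (db c a))
     \<oplus>\<^bsub>tensor_power scale 3\<^esub>
     tensor_permute scale 3 (cycle_of_list [0, 2, 1]) (bracket_L scale db c (db a b))"

definition weak_double_jacobiator ::
    "('k::field \<Rightarrow> 'a::{ring, monoid_mult} \<Rightarrow> 'a) \<Rightarrow> ('a \<Rightarrow> 'a \<Rightarrow> ('a list \<Rightarrow>\<^sub>0 'k) set)
     \<Rightarrow> 'a \<Rightarrow> 'a \<Rightarrow> 'a \<Rightarrow> ('a list \<Rightarrow>\<^sub>0 'k) set" where
  "weak_double_jacobiator scale db a b c =
     double_jacobiator scale db a b c
     \<ominus>\<^bsub>tensor_power scale 3\<^esub>
     tensor_permute scale 3 (cycle_of_list [0, 1]) (double_jacobiator scale db c b a)"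

locale weak_poisson_double_bracket = double_bracket +
  assumes weak_jacobi: "weak_double_jacobiator scale db a b c = \<zero>\<^bsub>tensor_power scale 3\<^esub>"


section \<open>Poisson brackets on commutative algebras\<close>

text \<open>
  Brackets are extensional functions (\<open>undefined\<close> outside the carrier), so that uniqueness
  of a bracket can be expressed by equality.
\<close>

locale antisymmetric_biderivation = algebra scalars R
  for R :: "('k::field, 'r, 'z) module_scheme" (structure)
  and B :: "'r \<Rightarrow> 'r \<Rightarrow> 'r" +
  assumes bracket_closed: "B \<in> carrier R \<rightarrow>\<^sub>E (carrier R \<rightarrow>\<^sub>E carrier R)"
    and bracket_add_left:
      "\<lbrakk>f \<in> carrier R; g \<in> carrier R; h \<in> carrier R\<rbrakk> \<Longrightarrow> B (f \<oplus>\<^bsub>R\<^esub> g) h = B f h \<oplus>\<^bsub>R\<^esub> B g h"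
    and bracket_add_right:
      "\<lbrakk>f \<in> carrier R; g \<in> carrier R; h \<in> carrier R\<rbrakk> \<Longrightarrow> B f (g \<oplus>\<^bsub>R\<^esub> h) = B f g \<oplus>\<^bsub>R\<^esub> B f h"
    and bracket_smult_left:
      "\<lbrakk>f \<in> carrier R; g \<in> carrier R\<rbrakk> \<Longrightarrow> B (c \<odot>\<^bsub>R\<^esub> f) g = c \<odot>\<^bsub>R\<^esub> B f g"
    and bracket_smult_right:
      "\<lbrakk>f \<in> carrier R; g \<in> carrier R\<rbrakk> \<Longrightarrow> B f (c \<odot>\<^bsub>R\<^esub> g) = c \<odot>\<^bsub>R\<^esub> B f g"
    and bracket_mult_left:
      "\<lbrakk>f \<in> carrier R; g \<in> carrier R; h \<in> carrier R\<rbrakk>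
        \<Longrightarrow> B (f \<otimes>\<^bsub>R\<^esub> g) h = f \<otimes>\<^bsub>R\<^esub> B g h \<oplus>\<^bsub>R\<^esub> B f h \<otimes>\<^bsub>R\<^esub> g"
    and bracket_mult_right:
      "\<lbrakk>f \<in> carrier R; g \<in> carrier R; h \<in> carrier R\<rbrakk>
        \<Longrightarrow> B f (g \<otimes>\<^bsub>R\<^esub> h) = g \<otimes>\<^bsub>R\<^esub> B f h \<oplus>\<^bsub>R\<^esub> B f g \<otimes>\<^bsub>R\<^esub> h"
    and bracket_antisym:
      "\<lbrakk>f \<in> carrier R; g \<in> carrier R\<rbrakk> \<Longrightarrow> B f g = \<ominus>\<^bsub>R\<^esub> B g f"

locale poisson_bracket = antisymmetric_biderivation +
  assumes jacobi:
      "\<lbrakk>f \<in> carrier R; g \<in> carrier R; h \<in> carrier R\<rbrakk>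
        \<Longrightarrow> B f (B g h) \<oplus>\<^bsub>R\<^esub> B g (B h f) \<oplus>\<^bsub>R\<^esub> B h (B f g) = \<zero>\<^bsub>R\<^esub>"

definition is_subalgebra :: "('k::field, 'r, 'z) module_scheme \<Rightarrow> 'r set \<Rightarrow> bool" where
  "is_subalgebra R S \<longleftrightarrow> subring S R \<and> (\<forall>c. \<forall>x\<in>S. c \<odot>\<^bsub>R\<^esub> x \<in> S)"


section \<open>The coordinate ring of the representation scheme\<close>

text \<open>
  Matrix indices range over a finite type \<open>'n\<close>, so the dimension is \<open>CARD('n)\<close>.
  The polynomial ring has one variable \<open>(a, i, j)\<close> for every symbol \<open>a\<^sub>i\<^sub>j\<close>; monomials are
  finitely supported exponent functions.
\<close>

type_synonym ('k, 'a, 'n) rep_poly = "(('a \<times> 'n \<times> 'n) \<Rightarrow>\<^sub>0 nat) \<Rightarrow>\<^sub>0 'k"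

definition poly_ring :: "('k::field, 'a, 'n) rep_poly ring" where
  "poly_ring = \<lparr>carrier = UNIV, monoid.mult = (*), one = 1, zero = 0, add = (+)\<rparr>"

definition var :: "'a \<Rightarrow> 'n \<Rightarrow> 'n \<Rightarrow> ('k::field, 'a, 'n) rep_poly" where
  "var a i j = Poly_Mapping.single (Poly_Mapping.single (a, i, j) 1) 1"

definition const :: "'k::field \<Rightarrow> ('k, 'a, 'n) rep_poly" where
  "const c = Poly_Mapping.single 0 c"

definition rep_relations ::
    "('k::field \<Rightarrow> 'a::{ring, monoid_mult} \<Rightarrow> 'a) \<Rightarrow> ('k, 'a, 'n::finite) rep_poly set" where
  "rep_relations scale =
     {const r * var a i j + const s * var b i j - var (scale r a + scale s b) i j
      | r s a b i j. True}
   \<union> {var 1 i j - (if i = j then 1 else 0) | i j. True}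
   \<union> {var (a * b) i j - (\<Sum>k\<in>UNIV. var a i k * var b k j) | a b i j. True}"

definition rep_ideal ::
    "('k::field \<Rightarrow> 'a::{ring, monoid_mult} \<Rightarrow> 'a) \<Rightarrow> ('k, 'a, 'n::finite) rep_poly set" where
  "rep_ideal scale = Idl\<^bsub>poly_ring\<^esub> (rep_relations scale)"

definition rep_algebra ::
    "('k::field \<Rightarrow> 'a::{ring, monoid_mult} \<Rightarrow> 'a)
     \<Rightarrow> ('k, ('k, 'a, 'n::finite) rep_poly set) module" where
  "rep_algebra scale =
     (let Q = poly_ring Quot rep_ideal scale in
      \<lparr>carrier = carrier Q, monoid.mult = monoid.mult Q, one = one Q, zero = zero Q, add = add Q,
       smult = (\<lambda>c F. (rep_ideal scale +>\<^bsub>poly_ring\<^esub> const c) \<otimes>\<^bsub>Q\<^esub> F)\<rparr>)"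

definition rep_entry ::
    "('k::field \<Rightarrow> 'a::{ring, monoid_mult} \<Rightarrow> 'a) \<Rightarrow> 'a \<Rightarrow> 'n \<Rightarrow> 'n
     \<Rightarrow> ('k, 'a, 'n::finite) rep_poly set" where
  "rep_entry scale a i j = rep_ideal scale +>\<^bsub>poly_ring\<^esub> var a i j"

definition trace_ring ::
    "('k::field \<Rightarrow> 'a::{ring, monoid_mult} \<Rightarrow> 'a) \<Rightarrow> ('k, 'a, 'n::finite) rep_poly set set" where
  "trace_ring scale =
     is_subalgebra (rep_algebra scale) hull
       {finsum (rep_algebra scale) (\<lambda>i. rep_entry scale a i i) UNIV | a. True}"

text \<open>The characterising property \<open>{a\<^sub>i\<^sub>j, b\<^sub>k\<^sub>l} = d'\<^sub>k\<^sub>l d''\<^sub>i\<^sub>j\<close>, where \<open>d\<close> is the double bracket of \<open>a, b\<close>.\<close>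

definition induced_bracket ::
    "('k::field \<Rightarrow> 'a::{ring, monoid_mult} \<Rightarrow> 'a) \<Rightarrow> ('a \<Rightarrow> 'a \<Rightarrow> ('a list \<Rightarrow>\<^sub>0 'k) set)
     \<Rightarrow> (('k, 'a, 'n::finite) rep_poly set \<Rightarrow> ('k, 'a, 'n) rep_poly set \<Rightarrow> ('k, 'a, 'n) rep_poly set)
     \<Rightarrow> bool" where
  "induced_bracket scale db B \<longleftrightarrow>
     antisymmetric_biderivation (rep_algebra scale) B \<and>
     (\<forall>a b i j k l.
        B (rep_entry scale a i j) (rep_entry scale b k l) =
        tensor_lift (rep_algebra scale)
          (\<lambda>xs. rep_entry scale (xs ! 0) k l \<otimes>\<^bsub>rep_algebra scale\<^esub> rep_entry scale (xs ! 1) i j)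
          (db a b))"

end

theory Submission
  imports Defs
begin

text \<open>
  Write \<open>a\<^sub>u\<close> with \<open>u = (i, j)\<close> for the class of the symbol \<open>a\<^sub>i\<^sub>j\<close>.  A tensor of degree two or three is
  evaluated at matrix positions by \<open>x \<otimes> y \<mapsto> x\<^sub>u y\<^sub>v\<close> and \<open>x \<otimes> y \<otimes> z \<mapsto> x\<^sub>u y\<^sub>v z\<^sub>w\<close>; these are the linear maps
  \<open>eval2 u v\<close> and \<open>eval3 u v w\<close>.  The prescribed values of the bracket then read
  \<open>{a\<^sub>u, b\<^sub>v} = eval2 v u \<lbrace>a, b\<rbrace>\<close>, and every axiom of the double bracket is translated into an identity
  in the commutative coordinate ring by evaluating both sides.  Such translations are equalities
  of linear maps on a tensor power, so it is enough to compare them on pure tensors.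

  Existence.  On the polynomial ring in the symbols any choice of values on pairs of variables
  extends to a biderivation.  With values chosen as representatives of \<open>eval2 v u \<lbrace>a, b\<rbrace>\<close>, the
  bracket of a defining relation with a variable lies in the ideal: for the relation of
  products this is the evaluated Leibniz rule in the first argument, and for the unit relation
  the consequence that \<open>\<lbrace>1, a\<rbrace>\<close> evaluates to zero.  Hence the ideal is preserved in the first
  argument, and in the second one because the bracket is antisymmetric modulo the ideal.

  Uniqueness and the reduction of the Jacobi identity to entries rest on the same principle: two
  derivations of the coordinate ring that agree on all entries are equal, and for an antisymmetric
  biderivation the Jacobiator is a derivation in each argument.

  The Jacobi identity on entries.  By the Leibniz rule \<open>{a\<^sub>u, {b\<^sub>v, c\<^sub>w}}\<close> has two summands, one for each
  leg of \<open>\<lbrace>b, c\<rbrace>\<close>.  The first is \<open>\<lbrace>a, \<lbrace>b, c\<rbrace>\<rbrace>\<^sub>L\<close> evaluated at \<open>w, u, v\<close>; the second, after swapping the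
  legs by antisymmetry, is minus \<open>\<lbrace>a, \<lbrace>c, b\<rbrace>\<rbrace>\<^sub>L\<close> evaluated at \<open>v, u, w\<close>.  Summed cyclically, the first
  summands give the double Jacobiator of \<open>a, b, c\<close> at \<open>w, u, v\<close> and the second ones that of
  \<open>c, b, a\<close> at \<open>u, w, v\<close>.  The exchange of the first two positions is the transposition in the weak
  double Jacobiator, so the sum is the latter evaluated at \<open>w, u, v\<close>
  (\<open>jacobi_entries\<close>), which vanishes.

  Traces.  Summing over diagonal positions, \<open>{tr a, tr b} = (tr d') (tr d'')\<close> with \<open>d = \<lbrace>a, b\<rbrace>\<close>, so brackets of
  generators stay in the trace ring; a derivation that maps the generators of a subalgebra into
  it maps the whole subalgebra into it.
\<close>

section \<open>Derivations of polynomial rings\<close>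

lemma poly_mapping_add_induct [case_names zero add]:
  assumes "P 0" and "\<And>k v f. P f \<Longrightarrow> P (Poly_Mapping.single k v + f)"
  shows "P (f :: 'b \<Rightarrow>\<^sub>0 'c::comm_monoid_add)"
proof (induction f rule: Poly_Mapping.update_induct)
  case (update f a b)
  have "Poly_Mapping.update a b f = Poly_Mapping.single a b + f"
  proof (rule poly_mapping_eqI)
    fix x
    show "Poly_Mapping.lookup (Poly_Mapping.update a b f) x
        = Poly_Mapping.lookup (Poly_Mapping.single a b + f) x"
      using update(1)
      by (auto simp: lookup_update lookup_add lookup_single when_def not_in_keys_iff_lookup_eq_zero)
  qed
  then show ?case using assms(2) update(3) by simp
qed (rule assms(1))

text \<open>
  The derivative of the monomial with exponents \<open>m\<close> under the derivation sending the variable \<open>u\<close> to \<open>\<delta> u\<close>.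
\<close>

definition monom_deriv ::
    "('x \<Rightarrow> ('x \<Rightarrow>\<^sub>0 nat) \<Rightarrow>\<^sub>0 'k) \<Rightarrow> ('x \<Rightarrow>\<^sub>0 nat) \<Rightarrow> ('x \<Rightarrow>\<^sub>0 nat) \<Rightarrow>\<^sub>0 'k::comm_ring_1" where
  "monom_deriv \<delta> m = (\<Sum>u\<in>Poly_Mapping.keys m.
     of_nat (Poly_Mapping.lookup m u) * Poly_Mapping.single (m - Poly_Mapping.single u 1) 1 * \<delta> u)"

text \<open>
  This is \<open>p \<mapsto> \<Sum>\<^sub>u (\<partial>p / \<partial>u) \<delta> u\<close>, the unique derivation over the coefficients that sends
  each variable \<open>u\<close> to \<open>\<delta> u\<close>.
\<close>

definition deriv_ext ::
    "('x \<Rightarrow> ('x \<Rightarrow>\<^sub>0 nat) \<Rightarrow>\<^sub>0 'k) \<Rightarrow> (('x \<Rightarrow>\<^sub>0 nat) \<Rightarrow>\<^sub>0 'k) \<Rightarrow> ('x \<Rightarrow>\<^sub>0 nat) \<Rightarrow>\<^sub>0 'k::comm_ring_1" where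
  "deriv_ext \<delta> p = (\<Sum>m\<in>Poly_Mapping.keys p.
     Poly_Mapping.single 0 (Poly_Mapping.lookup p m) * monom_deriv \<delta> m)"

lemma monom_deriv_superset:
  assumes "finite A" "Poly_Mapping.keys m \<subseteq> A"
  shows "monom_deriv \<delta> m = (\<Sum>u\<in>A.
     of_nat (Poly_Mapping.lookup m u) * Poly_Mapping.single (m - Poly_Mapping.single u 1) 1 * \<delta> u)"
  unfolding monom_deriv_def
  by (rule sum.mono_neutral_left) (use assms in \<open>auto simp: not_in_keys_iff_lookup_eq_zero\<close>)

text \<open>
  Subtraction of exponents is truncated, so lowering the exponent of \<open>u\<close> in \<open>m + m'\<close> is the same
  as lowering it in \<open>m\<close> only if \<open>u\<close> occurs in \<open>m\<close>; otherwise the numerical factor vanishes.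
\<close>

lemma lower_exponent_add:
  "(of_nat (Poly_Mapping.lookup m u) *
      Poly_Mapping.single (m + m' - Poly_Mapping.single u 1) 1 :: ('x \<Rightarrow>\<^sub>0 nat) \<Rightarrow>\<^sub>0 'k::comm_ring_1)
   = Poly_Mapping.single m' 1 *
      (of_nat (Poly_Mapping.lookup m u) * Poly_Mapping.single (m - Poly_Mapping.single u 1) 1)"
proof (cases "Poly_Mapping.lookup m u = 0")
  case False
  then have "m + m' - Poly_Mapping.single u 1 = m' + (m - Poly_Mapping.single u 1)"
    by (intro poly_mapping_eqI) (auto simp: lookup_add lookup_minus lookup_single when_def)
  then have "Poly_Mapping.single (m + m' - Poly_Mapping.single u 1) (1::'k)
      = Poly_Mapping.single m' 1 * Poly_Mapping.single (m - Poly_Mapping.single u 1) 1"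
    by (simp only: mult_single mult_1)
  then show ?thesis
    by (simp only: mult.left_commute)
qed simp

lemma monom_deriv_add:
  "monom_deriv \<delta> (m + m') =
     Poly_Mapping.single m 1 * monom_deriv \<delta> m' + Poly_Mapping.single m' 1 * monom_deriv \<delta> m"
proof -
  define A where "A = Poly_Mapping.keys m \<union> Poly_Mapping.keys m'"
  have A: "finite A" "Poly_Mapping.keys m \<subseteq> A" "Poly_Mapping.keys m' \<subseteq> A"
      "Poly_Mapping.keys (m + m') \<subseteq> A"
    using keys_add[of m m'] by (auto simp: A_def)
  have term_split: "of_nat (Poly_Mapping.lookup (m + m') u)
        * Poly_Mapping.single (m + m' - Poly_Mapping.single u 1) 1 * \<delta> u
      = Poly_Mapping.single m 1 * (of_nat (Poly_Mapping.lookup m' u)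
          * Poly_Mapping.single (m' - Poly_Mapping.single u 1) 1 * \<delta> u)
      + Poly_Mapping.single m' 1 * (of_nat (Poly_Mapping.lookup m u)
          * Poly_Mapping.single (m - Poly_Mapping.single u 1) 1 * \<delta> u)" for u
  proof -
    have "of_nat (Poly_Mapping.lookup (m + m') u)
        * Poly_Mapping.single (m + m' - Poly_Mapping.single u 1) 1 * \<delta> u =
      of_nat (Poly_Mapping.lookup m u)
        * Poly_Mapping.single (m + m' - Poly_Mapping.single u 1) 1 * \<delta> u
      + of_nat (Poly_Mapping.lookup m' u)
        * Poly_Mapping.single (m' + m - Poly_Mapping.single u 1) 1 * \<delta> u"
      by (simp add: lookup_add distrib_right add.commute[of m m'])
    then show ?thesis
      unfolding lower_exponent_add by (simp add: mult.assoc)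
  qed
  show ?thesis
    unfolding monom_deriv_superset[OF A(1,4)] monom_deriv_superset[OF A(1,2)]
      monom_deriv_superset[OF A(1,3)] term_split
    by (simp add: sum.distrib sum_distrib_left)
qed

lemma deriv_ext_zero [simp]: "deriv_ext \<delta> 0 = 0"
  by (simp add: deriv_ext_def)

lemma deriv_ext_add: "deriv_ext \<delta> (p + q) = deriv_ext \<delta> p + deriv_ext \<delta> q"
  unfolding deriv_ext_def
  by (rule setsum_keys_plus_distrib) (auto simp: single_add distrib_right)

lemma deriv_ext_single:
  "deriv_ext \<delta> (Poly_Mapping.single m c) = Poly_Mapping.single 0 c * monom_deriv \<delta> m"
  by (simp add: deriv_ext_def)

lemma deriv_ext_const [simp]: "deriv_ext \<delta> (Poly_Mapping.single 0 c) = 0"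
  by (simp add: deriv_ext_single monom_deriv_def)

lemma deriv_ext_var [simp]:
  "deriv_ext \<delta> (Poly_Mapping.single (Poly_Mapping.single u 1) 1) = \<delta> u"
  by (simp add: deriv_ext_single monom_deriv_def)

lemma deriv_ext_mult_single:
  "deriv_ext \<delta> (Poly_Mapping.single m c * Poly_Mapping.single m' c') =
     Poly_Mapping.single m c * deriv_ext \<delta> (Poly_Mapping.single m' c')
     + Poly_Mapping.single m' c' * deriv_ext \<delta> (Poly_Mapping.single m c)"
proof -
  have split: "Poly_Mapping.single n d = Poly_Mapping.single 0 d * Poly_Mapping.single n (1::'b)"
    for n :: "'a \<Rightarrow>\<^sub>0 nat" and d
    by (simp add: mult_single)
  have "Poly_Mapping.single (0::'a \<Rightarrow>\<^sub>0 nat) (c * c')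
      = Poly_Mapping.single 0 c * Poly_Mapping.single 0 c'"
    by (simp add: mult_single)
  then have "Poly_Mapping.single 0 (c * c') * (Poly_Mapping.single m 1 * x + Poly_Mapping.single m' 1 * y)
      = Poly_Mapping.single m c * (Poly_Mapping.single 0 c' * x)
        + Poly_Mapping.single m' c' * (Poly_Mapping.single 0 c * y)" for x y
    unfolding split[of m c] split[of m' c'] by (simp add: distrib_left mult_ac)
  then show ?thesis
    unfolding mult_single[of m c m' c'] deriv_ext_single monom_deriv_add by blast
qed

lemma deriv_ext_mult: "deriv_ext \<delta> (p * q) = p * deriv_ext \<delta> q + q * deriv_ext \<delta> p"
proof (induction p rule: poly_mapping_add_induct)
  case (add m c p)
  have "deriv_ext \<delta> (Poly_Mapping.single m c * q)
      = Poly_Mapping.single m c * deriv_ext \<delta> q + q * deriv_ext \<delta> (Poly_Mapping.single m c)"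
    by (induction q rule: poly_mapping_add_induct)
      (simp_all add: deriv_ext_add deriv_ext_mult_single algebra_simps)
  with add show ?case
    by (simp add: deriv_ext_add algebra_simps)
qed simp

lemma monom_deriv_fun_add: "monom_deriv (\<lambda>u. \<delta> u + \<epsilon> u) m = monom_deriv \<delta> m + monom_deriv \<epsilon> m"
  by (simp add: monom_deriv_def sum.distrib distrib_left)

lemma monom_deriv_fun_mult: "monom_deriv (\<lambda>u. r * \<delta> u) m = r * monom_deriv \<delta> m"
  by (simp add: monom_deriv_def sum_distrib_left mult.left_commute)

lemma deriv_ext_fun_zero: "deriv_ext (\<lambda>u. 0) p = 0"
  by (simp add: deriv_ext_def monom_deriv_def)

text \<open>
  As a function of the prescribed values the extension is linear over the polynomial ring.  This
  makes the iterated extension below a derivation in its second argument as well.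
\<close>

lemma deriv_ext_fun_add: "deriv_ext (\<lambda>u. \<delta> u + \<epsilon> u) p = deriv_ext \<delta> p + deriv_ext \<epsilon> p"
  by (simp add: deriv_ext_def sum.distrib distrib_left monom_deriv_fun_add)

lemma deriv_ext_fun_mult: "deriv_ext (\<lambda>u. r * \<delta> u) p = r * deriv_ext \<delta> p"
  by (simp add: deriv_ext_def sum_distrib_left mult.left_commute monom_deriv_fun_mult)

definition bideriv_ext ::
    "('x \<Rightarrow> 'x \<Rightarrow> ('x \<Rightarrow>\<^sub>0 nat) \<Rightarrow>\<^sub>0 'k) \<Rightarrow> (('x \<Rightarrow>\<^sub>0 nat) \<Rightarrow>\<^sub>0 'k) \<Rightarrow> (('x \<Rightarrow>\<^sub>0 nat) \<Rightarrow>\<^sub>0 'k)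
     \<Rightarrow> ('x \<Rightarrow>\<^sub>0 nat) \<Rightarrow>\<^sub>0 'k::comm_ring_1" where
  "bideriv_ext \<beta> p q = deriv_ext (\<lambda>u. deriv_ext (\<beta> u) q) p"

lemma bideriv_ext_add_left: "bideriv_ext \<beta> (p + p') q = bideriv_ext \<beta> p q + bideriv_ext \<beta> p' q"
  by (simp add: bideriv_ext_def deriv_ext_add)

lemma bideriv_ext_add_right: "bideriv_ext \<beta> p (q + q') = bideriv_ext \<beta> p q + bideriv_ext \<beta> p q'"
  by (simp add: bideriv_ext_def deriv_ext_add deriv_ext_fun_add)

lemma bideriv_ext_mult_left:
  "bideriv_ext \<beta> (p * p') q = p * bideriv_ext \<beta> p' q + p' * bideriv_ext \<beta> p q"
  by (simp add: bideriv_ext_def deriv_ext_mult)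

lemma bideriv_ext_mult_right:
  "bideriv_ext \<beta> p (q * q') = q * bideriv_ext \<beta> p q' + q' * bideriv_ext \<beta> p q"
  by (simp add: bideriv_ext_def deriv_ext_mult deriv_ext_fun_add deriv_ext_fun_mult)

text \<open>
  Constants and variables generate the polynomial ring under sums and products.  Identities for
  (bi)derivations are therefore checked on variables.
\<close>

lemma rep_poly_induct [case_names const var add mult]:
  fixes p :: "('k::field, 'a, 'n) rep_poly"
  assumes const: "\<And>c. P (const c)" and var: "\<And>a i j. P (var a i j)"
    and add: "\<And>p q. P p \<Longrightarrow> P q \<Longrightarrow> P (p + q)" and mult: "\<And>p q. P p \<Longrightarrow> P q \<Longrightarrow> P (p * q)"
  shows "P p"
proof -
  have pow: "P (Poly_Mapping.single (Poly_Mapping.single u k) 1)" for u :: "'a \<times> 'n \<times> 'n" and k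
  proof (induction k)
    case 0
    show ?case using const[of 1] by (simp add: const_def)
  next
    case (Suc k)
    obtain a i j where u: "u = (a, i, j)" by (cases u)
    have "Poly_Mapping.single (Poly_Mapping.single u (Suc k)) 1
        = var a i j * Poly_Mapping.single (Poly_Mapping.single u k) (1::'k)"
      by (simp add: var_def u mult_single flip: single_add)
    with mult[OF var Suc] show ?case by simp
  qed
  have monom: "P (Poly_Mapping.single m 1)" for m
  proof (induction m rule: poly_mapping_add_induct)
    case zero
    show ?case using const[of 1] by (simp add: const_def)
  next
    case (add u k m)
    have "Poly_Mapping.single (Poly_Mapping.single u k + m) 1
        = Poly_Mapping.single (Poly_Mapping.single u k) 1 * Poly_Mapping.single m (1::'k)"
      by (simp add: mult_single)
    with mult[OF pow add] show ?case by simp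
  qed
  show ?thesis
  proof (induction p rule: poly_mapping_add_induct)
    case zero
    show ?case using const[of 0] by (simp add: const_def)
  next
    case (add m c p)
    have "Poly_Mapping.single m c = const c * Poly_Mapping.single m (1::'k)"
      by (simp add: mult_single const_def)
    then have "P (Poly_Mapping.single m c)" using mult[OF const monom] by simp
    then show ?case using add assms(3) by blast
  qed
qed

lemma bideriv_ext_const_left [simp]: "bideriv_ext \<beta> (const c) q = 0"
  by (simp add: bideriv_ext_def const_def)

lemma bideriv_ext_const_right [simp]: "bideriv_ext \<beta> p (const c) = 0"
  by (simp add: bideriv_ext_def const_def deriv_ext_fun_zero)

lemma bideriv_ext_var [simp]:
  "bideriv_ext \<beta> (var a i j) (var b k l) = \<beta> (a, i, j) (b, k, l)"
  by (simp add: bideriv_ext_def var_def del: One_nat_def)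

lemma bideriv_ext_zero_left [simp]: "bideriv_ext \<beta> 0 q = 0"
  by (simp add: bideriv_ext_def)

lemma bideriv_ext_diff_left: "bideriv_ext \<beta> (p - p') q = bideriv_ext \<beta> p q - bideriv_ext \<beta> p' q"
  using bideriv_ext_add_left[of \<beta> "p - p'" p' q] by simp

lemma bideriv_ext_diff_right: "bideriv_ext \<beta> p (q - q') = bideriv_ext \<beta> p q - bideriv_ext \<beta> p q'"
  using bideriv_ext_add_right[of \<beta> p "q - q'" q'] by simp

lemma bideriv_ext_sum_left: "bideriv_ext \<beta> (\<Sum>k\<in>A. p k) q = (\<Sum>k\<in>A. bideriv_ext \<beta> (p k) q)"
  by (induction A rule: infinite_finite_induct) (simp_all add: bideriv_ext_add_left)

section \<open>Tensor powers and their universal property\<close>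

lemma scalars_simps [simp]:
  "carrier scalars = UNIV" "monoid.mult scalars = (*)" "one scalars = 1"
  "zero scalars = 0" "add scalars = (+)"
  by (simp_all add: scalars_def)

lemma cring_scalars: "cring (scalars :: 'k::field ring)"
proof (rule cringI)
  show "abelian_group (scalars :: 'k ring)"
    by (rule abelian_groupI) (auto simp: algebra_simps intro: exI[of _ "- _"])
  show "comm_monoid (scalars :: 'k ring)"
    by unfold_locales (auto simp: algebra_simps)
qed (simp add: algebra_simps)

lemma lookup_formal_scale [simp]:
  "Poly_Mapping.lookup (formal_scale c p) x = c * Poly_Mapping.lookup p x"
  by (simp add: formal_scale_def Poly_Mapping.map.rep_eq when_def)

interpretation formal: vector_space "formal_scale :: 'k::field \<Rightarrow> ('b \<Rightarrow>\<^sub>0 'k) \<Rightarrow> ('b \<Rightarrow>\<^sub>0 'k)"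
  by unfold_locales (auto intro!: poly_mapping_eqI simp: lookup_add algebra_simps)

lemma formal_scale_single [simp]:
  "formal_scale c (Poly_Mapping.single x d) = Poly_Mapping.single x (c * d)"
  by (rule poly_mapping_eqI) (simp add: lookup_single when_def)

text \<open>
  The formal sums whose classes make up the \<open>m\<close>-th tensor power.  Outside this set a
  multilinear function need not take values in its target module.
\<close>

definition formal_tensors :: "nat \<Rightarrow> ('a list \<Rightarrow>\<^sub>0 'k::field) set" where
  "formal_tensors m = {p. \<forall>xs\<in>Poly_Mapping.keys p. length xs = m}"

lemma single_in_formal_tensors: "length xs = m \<Longrightarrow> Poly_Mapping.single xs c \<in> formal_tensors m"
  by (simp add: formal_tensors_def)

lemma subspace_formal_tensors:
  "formal.subspace (formal_tensors m :: ('a list \<Rightarrow>\<^sub>0 'k::field) set)"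
proof (rule formal.subspaceI)
  fix p q :: "'a list \<Rightarrow>\<^sub>0 'k::field" and c
  assume p: "p \<in> formal_tensors m"
  then show "formal_scale c p \<in> formal_tensors m"
    by (auto simp: formal_tensors_def in_keys_iff)
  assume "q \<in> formal_tensors m"
  with p show "p + q \<in> formal_tensors m"
    using keys_add[of p q] by (auto simp: formal_tensors_def)
qed (simp add: formal_tensors_def)

lemmas formal_tensors_closed =
  formal.subspace_0[OF subspace_formal_tensors] formal.subspace_add[OF subspace_formal_tensors]
  formal.subspace_diff[OF subspace_formal_tensors] formal.subspace_scale[OF subspace_formal_tensors]

lemma tensor_class_eq_iff:
  "tensor_class scale m p = tensor_class scale m q \<longleftrightarrow>
     p - q \<in> formal.span (multilinear_relations scale m)" (is "_ \<longleftrightarrow> _ \<in> ?N")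
proof
  have "p \<in> tensor_class scale m p"
    by (simp add: tensor_class_def formal.span_zero)
  moreover assume "tensor_class scale m p = tensor_class scale m q"
  ultimately have "p \<in> tensor_class scale m q" by simp
  then show "p - q \<in> ?N"
    by (simp add: tensor_class_def)
next
  assume pq: "p - q \<in> ?N"
  have "r - p \<in> ?N \<longleftrightarrow> r - q \<in> ?N" for r
    using formal.span_add[OF _ pq, of "r - p"] formal.span_diff[OF _ pq, of "r - q"] by auto
  then show "tensor_class scale m p = tensor_class scale m q"
    by (simp add: tensor_class_def)
qed

text \<open>
  The classes form a partition, hence any member of a class represents it; this justifies the
  choice of representatives in the operations on tensors.
\<close>

lemma in_tensor_class_iff:
  "q \<in> tensor_class scale m p \<longleftrightarrow> tensor_class scale m q = tensor_class scale m p"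
  by (simp add: tensor_class_eq_iff) (simp add: tensor_class_def)

lemma tensor_class_self: "p \<in> tensor_class scale m p"
  by (simp add: in_tensor_class_iff)

lemma tensor_carrierI: "p \<in> formal_tensors m \<Longrightarrow> tensor_class scale m p \<in> carrier (tensor_power scale m)"
  by (auto simp: tensor_power_def formal_tensors_def)

lemma tensor_carrierE:
  assumes "d \<in> carrier (tensor_power scale m)"
  obtains p where "p \<in> formal_tensors m" "d = tensor_class scale m p"
  using assms by (auto simp: tensor_power_def formal_tensors_def)

lemma tensor_zero: "\<zero>\<^bsub>tensor_power scale m\<^esub> = tensor_class scale m 0"
  by (simp add: tensor_power_def)

lemma tensor_add:
  "tensor_class scale m p \<oplus>\<^bsub>tensor_power scale m\<^esub> tensor_class scale m q = tensor_class scale m (p + q)"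
proof -
  have eq: "tensor_class scale m (p' + q') = tensor_class scale m (p + q)"
    if "p' \<in> tensor_class scale m p" "q' \<in> tensor_class scale m q" for p' q'
    using formal.span_add[of "p' - p" _ "q' - q"] that
    by (simp add: tensor_class_eq_iff) (simp add: tensor_class_def algebra_simps)
  have "(\<Union>p'\<in>tensor_class scale m p. \<Union>q'\<in>tensor_class scale m q. tensor_class scale m (p' + q'))
      = (\<Union>p'\<in>tensor_class scale m p. \<Union>q'\<in>tensor_class scale m q. tensor_class scale m (p + q))"
    by (intro SUP_cong refl eq)
  also have "\<dots> = tensor_class scale m (p + q)"
    using tensor_class_self[of p scale m] tensor_class_self[of q scale m] by blast
  finally show ?thesis by (simp add: tensor_power_def)
qed

lemma tensor_smult:
  "c \<odot>\<^bsub>tensor_power scale m\<^esub> tensor_class scale m p = tensor_class scale m (formal_scale c p)"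
proof -
  have eq: "tensor_class scale m (formal_scale c p') = tensor_class scale m (formal_scale c p)"
    if "p' \<in> tensor_class scale m p" for p'
    using formal.span_scale[of "p' - p" _ c] that
    by (simp add: tensor_class_eq_iff formal.scale_right_diff_distrib) (simp add: tensor_class_def)
  have "(\<Union>p'\<in>tensor_class scale m p. tensor_class scale m (formal_scale c p'))
      = (\<Union>p'\<in>tensor_class scale m p. tensor_class scale m (formal_scale c p))"
    by (intro SUP_cong refl eq)
  also have "\<dots> = tensor_class scale m (formal_scale c p)"
    using tensor_class_self[of p scale m] by blast
  finally show ?thesis by (simp add: tensor_power_def)
qed

lemma module_tensor_power: "Module.module scalars (tensor_power scale m)"
proof (rule moduleI[OF cring_scalars])
  show "abelian_group (tensor_power scale m)"
  proof (rule abelian_groupI)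
    fix x assume "x \<in> carrier (tensor_power scale m)"
    then obtain p where p: "p \<in> formal_tensors m" "x = tensor_class scale m p"
      by (rule tensor_carrierE)
    have "formal_scale (- 1) p \<in> formal_tensors m"
      using p by (intro formal_tensors_closed)
    then show "\<exists>y\<in>carrier (tensor_power scale m). y \<oplus>\<^bsub>tensor_power scale m\<^esub> x = \<zero>\<^bsub>tensor_power scale m\<^esub>"
      by (intro bexI[of _ "tensor_class scale m (formal_scale (- 1) p)"])
        (simp_all add: p tensor_add tensor_zero tensor_carrierI)
  qed (auto elim!: tensor_carrierE simp: tensor_add tensor_zero add_ac
        intro!: tensor_carrierI formal_tensors_closed)
qed (auto elim!: tensor_carrierE simp: tensor_add tensor_smult formal.scale_left_distrib
      formal.scale_right_distrib intro!: tensor_carrierI formal_tensors_closed)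

lemma pure_tensor_closed: "length xs = m \<Longrightarrow> pure_tensor scale xs \<in> carrier (tensor_power scale m)"
  by (auto simp: pure_tensor_def intro!: tensor_carrierI single_in_formal_tensors)

lemma tensor_induct [consumes 1, case_names zero pure add]:
  assumes d: "d \<in> carrier (tensor_power scale m)"
    and zero: "P \<zero>\<^bsub>tensor_power scale m\<^esub>"
    and pure: "\<And>c xs. length xs = m \<Longrightarrow> P (c \<odot>\<^bsub>tensor_power scale m\<^esub> pure_tensor scale xs)"
    and add: "\<And>x y. x \<in> carrier (tensor_power scale m) \<Longrightarrow> y \<in> carrier (tensor_power scale m) \<Longrightarrow>
      P x \<Longrightarrow> P y \<Longrightarrow> P (x \<oplus>\<^bsub>tensor_power scale m\<^esub> y)"
  shows "P d"
proof -
  have "p \<in> formal_tensors m \<Longrightarrow> P (tensor_class scale m p)" for p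
  proof (induction p rule: Poly_Mapping.update_induct)
    case const
    then show ?case using zero by (simp add: tensor_zero)
  next
    case (update f xs c)
    have split: "Poly_Mapping.update xs c f = Poly_Mapping.single xs c + f"
      using update(1)
      by (intro poly_mapping_eqI) (auto simp: lookup_update lookup_add lookup_single when_def
          not_in_keys_iff_lookup_eq_zero)
    have "length xs = m" and f: "f \<in> formal_tensors m"
      using update(2,4) by (auto simp: formal_tensors_def keys_update)
    moreover from this have
      "tensor_class scale m (Poly_Mapping.single xs c) = c \<odot>\<^bsub>tensor_power scale m\<^esub> pure_tensor scale xs"
      by (simp add: pure_tensor_def tensor_smult)
    ultimately have "P (tensor_class scale m (Poly_Mapping.single xs c))"
      using pure by simp
    with update(3)[OF f] show ?case
      using \<open>length xs = m\<close> f add unfolding split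
      by (metis tensor_add tensor_carrierI single_in_formal_tensors)
  qed
  then show ?thesis using d by (auto elim: tensor_carrierE)
qed

text \<open>
  Multilinearity is expressed by updating one entry of a list, in the form of the defining
  relations of the tensor power.
\<close>

definition multilinear_map ::
    "('k::field \<Rightarrow> 'a::{ring, monoid_mult} \<Rightarrow> 'a) \<Rightarrow> nat \<Rightarrow> ('k, 'v, 'z) module_scheme
     \<Rightarrow> ('a list \<Rightarrow> 'v) \<Rightarrow> bool" where
  "multilinear_map scale m V f \<longleftrightarrow>
     (\<forall>xs. length xs = m \<longrightarrow> f xs \<in> carrier V) \<and>
     (\<forall>xs i u v. length xs = m \<and> i < m \<longrightarrow> f (xs[i := u + v]) = f (xs[i := u]) \<oplus>\<^bsub>V\<^esub> f (xs[i := v])) \<and>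
     (\<forall>xs i c u. length xs = m \<and> i < m \<longrightarrow> f (xs[i := scale c u]) = c \<odot>\<^bsub>V\<^esub> f (xs[i := u]))"

lemma multilinear_map_cong:
  assumes "multilinear_map scale m V f" and "\<And>xs. length xs = m \<Longrightarrow> g xs = f xs"
  shows "multilinear_map scale m V g"
  using assms unfolding multilinear_map_def by simp

definition module_map ::
    "('k::field, 'v, 'y) module_scheme \<Rightarrow> ('k, 'w, 'z) module_scheme \<Rightarrow> ('v \<Rightarrow> 'w) \<Rightarrow> bool" where
  "module_map V W h \<longleftrightarrow>
     h \<in> carrier V \<rightarrow> carrier W \<and>
     (\<forall>x\<in>carrier V. \<forall>y\<in>carrier V. h (x \<oplus>\<^bsub>V\<^esub> y) = h x \<oplus>\<^bsub>W\<^esub> h y) \<and>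
     (\<forall>c. \<forall>x\<in>carrier V. h (c \<odot>\<^bsub>V\<^esub> x) = c \<odot>\<^bsub>W\<^esub> h x)"

lemma module_mapI:
  assumes "\<And>x. x \<in> carrier V \<Longrightarrow> h x \<in> carrier W"
    and "\<And>x y. x \<in> carrier V \<Longrightarrow> y \<in> carrier V \<Longrightarrow> h (x \<oplus>\<^bsub>V\<^esub> y) = h x \<oplus>\<^bsub>W\<^esub> h y"
    and "\<And>c x. x \<in> carrier V \<Longrightarrow> h (c \<odot>\<^bsub>V\<^esub> x) = c \<odot>\<^bsub>W\<^esub> h x"
  shows "module_map V W h"
  using assms by (auto simp: module_map_def)

lemma module_map_closed: "module_map V W h \<Longrightarrow> x \<in> carrier V \<Longrightarrow> h x \<in> carrier W"
  and module_map_add: "module_map V W h \<Longrightarrow> x \<in> carrier V \<Longrightarrow> y \<in> carrier V \<Longrightarrow>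
    h (x \<oplus>\<^bsub>V\<^esub> y) = h x \<oplus>\<^bsub>W\<^esub> h y"
  and module_map_smult: "module_map V W h \<Longrightarrow> x \<in> carrier V \<Longrightarrow> h (c \<odot>\<^bsub>V\<^esub> x) = c \<odot>\<^bsub>W\<^esub> h x"
  by (auto simp: module_map_def)

lemma module_map_zero:
  assumes V: "Module.module (scalars :: 'k::field ring) V" and W: "Module.module scalars W"
    and h: "module_map V W h"
  shows "h \<zero>\<^bsub>V\<^esub> = \<zero>\<^bsub>W\<^esub>"
proof -
  interpret V: Module.module scalars V by (rule V)
  interpret W: Module.module scalars W by (rule W)
  have "h (0 \<odot>\<^bsub>V\<^esub> \<zero>\<^bsub>V\<^esub>) = 0 \<odot>\<^bsub>W\<^esub> h \<zero>\<^bsub>V\<^esub>"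
    by (intro module_map_smult[OF h]) simp
  then show ?thesis
    using V.smult_r_null[of 0] W.smult_l_null[OF module_map_closed[OF h V.M.zero_closed]] by simp
qed

lemma module_map_uminus:
  assumes V: "Module.module (scalars :: 'k::field ring) V" and W: "Module.module scalars W"
    and h: "module_map V W h" and x: "x \<in> carrier V"
  shows "h (\<ominus>\<^bsub>V\<^esub> x) = \<ominus>\<^bsub>W\<^esub> h x"
proof -
  interpret V: Module.module scalars V by (rule V)
  interpret W: Module.module scalars W by (rule W)
  have "h (\<ominus>\<^bsub>V\<^esub> x) \<oplus>\<^bsub>W\<^esub> h x = h (\<ominus>\<^bsub>V\<^esub> x \<oplus>\<^bsub>V\<^esub> x)"
    using x by (simp add: module_map_add[OF h])
  also have "\<dots> = \<zero>\<^bsub>W\<^esub>"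
    using x by (simp add: V.M.l_neg module_map_zero[OF V W h])
  finally show ?thesis
    using x by (metis W.M.minus_equality V.M.a_inv_closed module_map_closed[OF h])
qed

lemma module_map_comp:
  assumes "module_map U V g" "module_map V W h"
  shows "module_map U W (\<lambda>x. h (g x))"
  using assms by (auto simp: module_map_def Pi_iff)

lemma module_map_plus:
  assumes W: "Module.module (scalars :: 'k::field ring) W"
    and g: "module_map V W g" and h: "module_map V W h"
  shows "module_map V W (\<lambda>x. g x \<oplus>\<^bsub>W\<^esub> h x)"
proof -
  interpret W: Module.module scalars W by (rule W)
  show ?thesis
    using W.smult_r_distr g h
    by (intro module_mapI)
      (auto simp: module_map_closed[OF g] module_map_closed[OF h] module_map_add[OF g]
        module_map_add[OF h] module_map_smult[OF g] module_map_smult[OF h] W.M.a_ac)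
qed

lemma module_map_finsum:
  assumes W: "Module.module (scalars :: 'k::field ring) W"
    and h: "\<And>i. module_map V W (h i)"
  shows "module_map V W (\<lambda>x. \<Oplus>\<^bsub>W\<^esub>i\<in>(A::'i::finite set). h i x)"
proof -
  interpret W: Module.module scalars W by (rule W)
  have hC: "(\<lambda>i. h i x) \<in> A \<rightarrow> carrier W" if "x \<in> carrier V" for x
    using that h by (auto intro: module_map_closed)
  show ?thesis
  proof (rule module_mapI)
    fix x y c assume x: "x \<in> carrier V"
    show "(\<Oplus>\<^bsub>W\<^esub>i\<in>A. h i x) \<in> carrier W"
      using hC[OF x] by simp
    have "(\<Oplus>\<^bsub>W\<^esub>i\<in>A. h i (c \<odot>\<^bsub>V\<^esub> x)) = (\<Oplus>\<^bsub>W\<^esub>i\<in>A. c \<odot>\<^bsub>W\<^esub> h i x)"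
      by (simp add: module_map_smult[OF h x])
    then show "(\<Oplus>\<^bsub>W\<^esub>i\<in>A. h i (c \<odot>\<^bsub>V\<^esub> x)) = c \<odot>\<^bsub>W\<^esub> (\<Oplus>\<^bsub>W\<^esub>i\<in>A. h i x)"
      using W.finsum_smult_ldistr[OF _ _ hC[OF x]] by simp
    assume y: "y \<in> carrier V"
    have "(\<Oplus>\<^bsub>W\<^esub>i\<in>A. h i (x \<oplus>\<^bsub>V\<^esub> y)) = (\<Oplus>\<^bsub>W\<^esub>i\<in>A. h i x \<oplus>\<^bsub>W\<^esub> h i y)"
      by (simp add: module_map_add[OF h x y])
    then show "(\<Oplus>\<^bsub>W\<^esub>i\<in>A. h i (x \<oplus>\<^bsub>V\<^esub> y)) = (\<Oplus>\<^bsub>W\<^esub>i\<in>A. h i x) \<oplus>\<^bsub>W\<^esub> (\<Oplus>\<^bsub>W\<^esub>i\<in>A. h i y)"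
      using W.M.finsum_addf[OF hC[OF x] hC[OF y]] by simp
  qed
qed


text \<open>
  The value of \<open>tensor_lift\<close> computed from a given formal sum instead of a chosen one.
\<close>

definition formal_lift ::
    "('k::field, 'v, 'z) module_scheme \<Rightarrow> ('a list \<Rightarrow> 'v) \<Rightarrow> ('a list \<Rightarrow>\<^sub>0 'k) \<Rightarrow> 'v" where
  "formal_lift V f p =
     finsum V (\<lambda>xs. Poly_Mapping.lookup p xs \<odot>\<^bsub>V\<^esub> f xs) (Poly_Mapping.keys p)"

context
  fixes scale :: "'k::field \<Rightarrow> 'a::{ring, monoid_mult} \<Rightarrow> 'a"
    and V :: "('k, 'v, 'z) module_scheme" and m :: nat and f :: "'a list \<Rightarrow> 'v"
  assumes V: "Module.module (scalars :: 'k ring) V" and f: "multilinear_map scale m V f"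
begin

interpretation V: Module.module scalars V by (rule V)

lemma module_one_smult: "x \<in> carrier V \<Longrightarrow> 1 \<odot>\<^bsub>V\<^esub> x = x"
  using V.smult_one by simp

lemma multilinear_map_closed: "length xs = m \<Longrightarrow> f xs \<in> carrier V"
  using f by (simp add: multilinear_map_def)

lemma formal_lift_superset:
  assumes "finite A" "Poly_Mapping.keys p \<subseteq> A" "\<And>xs. xs \<in> A \<Longrightarrow> length xs = m"
  shows "formal_lift V f p = (\<Oplus>\<^bsub>V\<^esub>xs\<in>A. Poly_Mapping.lookup p xs \<odot>\<^bsub>V\<^esub> f xs)"
  unfolding formal_lift_def
  by (rule V.M.add.finprod_mono_neutral_cong_left)
    (use assms V.smult_l_null V.smult_closed multilinear_map_closed in \<open>auto simp: in_keys_iff\<close>)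

lemma formal_lift_closed: "p \<in> formal_tensors m \<Longrightarrow> formal_lift V f p \<in> carrier V"
  unfolding formal_lift_def
  by (rule V.M.finsum_closed) (use V.smult_closed multilinear_map_closed in \<open>auto simp: formal_tensors_def\<close>)

lemma formal_lift_add:
  assumes "p \<in> formal_tensors m" "q \<in> formal_tensors m"
  shows "formal_lift V f (p + q) = formal_lift V f p \<oplus>\<^bsub>V\<^esub> formal_lift V f q"
proof -
  define A where "A = Poly_Mapping.keys p \<union> Poly_Mapping.keys q"
  have A: "finite A" "Poly_Mapping.keys (p + q) \<subseteq> A" "Poly_Mapping.keys p \<subseteq> A"
      "Poly_Mapping.keys q \<subseteq> A" "\<And>xs. xs \<in> A \<Longrightarrow> length xs = m"
    using assms keys_add[of p q] by (auto simp: A_def formal_tensors_def)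
  have "(\<Oplus>\<^bsub>V\<^esub>xs\<in>A. Poly_Mapping.lookup (p + q) xs \<odot>\<^bsub>V\<^esub> f xs) =
      (\<Oplus>\<^bsub>V\<^esub>xs\<in>A. Poly_Mapping.lookup p xs \<odot>\<^bsub>V\<^esub> f xs \<oplus>\<^bsub>V\<^esub> Poly_Mapping.lookup q xs \<odot>\<^bsub>V\<^esub> f xs)"
    by (intro V.M.finsum_cong')
      (use V.smult_l_distr V.smult_closed multilinear_map_closed A(5) in \<open>auto simp: lookup_add\<close>)
  also have "\<dots> = (\<Oplus>\<^bsub>V\<^esub>xs\<in>A. Poly_Mapping.lookup p xs \<odot>\<^bsub>V\<^esub> f xs)
      \<oplus>\<^bsub>V\<^esub> (\<Oplus>\<^bsub>V\<^esub>xs\<in>A. Poly_Mapping.lookup q xs \<odot>\<^bsub>V\<^esub> f xs)"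
    by (intro V.M.finsum_addf) (use V.smult_closed multilinear_map_closed A(5) in auto)
  finally show ?thesis
    using formal_lift_superset[OF A(1,2,5)] formal_lift_superset[OF A(1,3,5)]
      formal_lift_superset[OF A(1,4,5)] by simp
qed

lemma formal_lift_scale:
  assumes "p \<in> formal_tensors m"
  shows "formal_lift V f (formal_scale c p) = c \<odot>\<^bsub>V\<^esub> formal_lift V f p"
proof -
  define A where "A = Poly_Mapping.keys p"
  have A: "finite A" "Poly_Mapping.keys (formal_scale c p) \<subseteq> A" "Poly_Mapping.keys p \<subseteq> A"
      "\<And>xs. xs \<in> A \<Longrightarrow> length xs = m"
    using assms by (auto simp: A_def formal_tensors_def in_keys_iff)
  have "(\<Oplus>\<^bsub>V\<^esub>xs\<in>A. Poly_Mapping.lookup (formal_scale c p) xs \<odot>\<^bsub>V\<^esub> f xs) =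
      (\<Oplus>\<^bsub>V\<^esub>xs\<in>A. c \<odot>\<^bsub>V\<^esub> (Poly_Mapping.lookup p xs \<odot>\<^bsub>V\<^esub> f xs))"
    by (intro V.M.finsum_cong')
      (use V.smult_assoc1 V.smult_closed multilinear_map_closed A(4) in auto)
  also have "\<dots> = c \<odot>\<^bsub>V\<^esub> (\<Oplus>\<^bsub>V\<^esub>xs\<in>A. Poly_Mapping.lookup p xs \<odot>\<^bsub>V\<^esub> f xs)"
    by (intro V.finsum_smult_ldistr[symmetric]) (use V.smult_closed multilinear_map_closed A(1,4) in auto)
  finally show ?thesis
    using formal_lift_superset[OF A(1,2,4)] formal_lift_superset[OF A(1,3,4)] by simp
qed

lemma formal_lift_single:
  assumes "length xs = m"
  shows "formal_lift V f (Poly_Mapping.single xs c) = c \<odot>\<^bsub>V\<^esub> f xs"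
  using formal_lift_superset[of "{xs}" "Poly_Mapping.single xs c"] assms multilinear_map_closed[OF assms]
    V.smult_closed[of c "f xs"]
  by simp

lemma formal_lift_diff_eq_zero:
  assumes "p \<in> formal_tensors m" "q \<in> formal_tensors m" "formal_lift V f p = formal_lift V f q"
  shows "formal_lift V f (p - q) = \<zero>\<^bsub>V\<^esub>"
proof -
  have pq: "p - q \<in> formal_tensors m"
    using assms by (intro formal_tensors_closed)
  from formal_lift_add[OF pq assms(2)] assms(3)
  have "formal_lift V f (p - q) \<oplus>\<^bsub>V\<^esub> formal_lift V f q = formal_lift V f q" by simp
  then show ?thesis
    using formal_lift_closed[OF pq] formal_lift_closed[OF assms(2)] by simp
qed

text \<open>
  A multilinear function turns each defining relation of the tensor power into zero, so its linear
  extension to formal sums factors through the quotient.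
\<close>

lemma formal_lift_relation:
  assumes "p \<in> formal.span (multilinear_relations scale m)"
  shows "p \<in> formal_tensors m \<and> formal_lift V f p = \<zero>\<^bsub>V\<^esub>"
  using assms
proof (induction p rule: formal.span_induct)
  case base
  show ?case
  proof (rule formal.subspaceI)
    show "0 \<in> {p. p \<in> formal_tensors m \<and> formal_lift V f p = \<zero>\<^bsub>V\<^esub>}"
      by (simp add: formal_tensors_closed formal_lift_def)
    show "formal_scale c p \<in> {p. p \<in> formal_tensors m \<and> formal_lift V f p = \<zero>\<^bsub>V\<^esub>}"
      if "p \<in> {p. p \<in> formal_tensors m \<and> formal_lift V f p = \<zero>\<^bsub>V\<^esub>}" for c p
      using that V.smult_r_null by (auto simp: formal_tensors_closed formal_lift_scale)
  qed (auto simp: formal_tensors_closed formal_lift_add)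
next
  case (step p)
  then consider
      (plus) xs i u v where "length xs = m" "i < m"
        "p = Poly_Mapping.single (xs[i := u + v]) 1
          - Poly_Mapping.single (xs[i := u]) 1 - Poly_Mapping.single (xs[i := v]) 1"
    | (times) xs i c u where "length xs = m" "i < m"
        "p = Poly_Mapping.single (xs[i := scale c u]) 1 - Poly_Mapping.single (xs[i := u]) c"
    unfolding multilinear_relations_def by auto
  then show ?case
  proof cases
    case plus
    let ?q = "Poly_Mapping.single (xs[i := u]) 1 + Poly_Mapping.single (xs[i := v]) (1::'k)"
    have "p = Poly_Mapping.single (xs[i := u + v]) 1 - ?q"
      using plus(3) by (simp add: algebra_simps)
    moreover have "formal_lift V f (Poly_Mapping.single (xs[i := u + v]) 1) = formal_lift V f ?q"
      using plus f multilinear_map_closed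
      by (simp add: formal_lift_add single_in_formal_tensors formal_lift_single multilinear_map_def
          module_one_smult)
    ultimately show ?thesis
      using plus(1)
      by (simp add: formal_lift_diff_eq_zero formal_tensors_closed single_in_formal_tensors)
  next
    case times
    have "formal_lift V f (Poly_Mapping.single (xs[i := scale c u]) 1)
        = formal_lift V f (Poly_Mapping.single (xs[i := u]) c)"
      using times f multilinear_map_closed V.smult_closed
      by (simp add: formal_lift_single multilinear_map_def module_one_smult)
    then show ?thesis
      using times(1) unfolding times(3)
      by (simp add: formal_lift_diff_eq_zero formal_tensors_closed single_in_formal_tensors)
  qed
qed

text \<open>
  The chosen representative differs from \<open>p\<close> by relations, which the extension kills.
\<close>

lemma tensor_lift_class:
  assumes p: "p \<in> formal_tensors m"
  shows "tensor_lift V f (tensor_class scale m p) = formal_lift V f p"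
proof -
  define q where "q = (SOME q. q \<in> tensor_class scale m p)"
  have "q \<in> tensor_class scale m p"
    unfolding q_def using tensor_class_self by (rule someI)
  then have diff: "q - p \<in> formal_tensors m" "formal_lift V f (q - p) = \<zero>\<^bsub>V\<^esub>"
    using formal_lift_relation[of "q - p"] by (simp_all add: tensor_class_def)
  have "formal_lift V f (q - p + p) = formal_lift V f p"
    unfolding formal_lift_add[OF diff(1) p] diff(2) using formal_lift_closed[OF p] by simp
  then show ?thesis
    by (simp add: tensor_lift_def formal_lift_def q_def)
qed

lemma tensor_lift_module_map: "module_map (tensor_power scale m) V (tensor_lift V f)"
  by (rule module_mapI)
    (auto elim!: tensor_carrierE simp: tensor_add tensor_smult tensor_lift_class
      formal_tensors_closed formal_lift_closed formal_lift_add formal_lift_scale)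

lemma tensor_lift_pure: "length xs = m \<Longrightarrow> tensor_lift V f (pure_tensor scale xs) = f xs"
  using multilinear_map_closed
  by (simp add: pure_tensor_def tensor_lift_class single_in_formal_tensors formal_lift_single
      module_one_smult)

end

text \<open>
  The uniqueness half of the universal property.  It is the tool by which all identities between
  evaluated tensors are obtained.
\<close>

lemma module_map_eq_if_eq_on_pure:
  assumes V: "Module.module (scalars :: 'k::field ring) V"
    and g: "module_map (tensor_power scale m) V g" and h: "module_map (tensor_power scale m) V h"
    and pure: "\<And>xs. length xs = m \<Longrightarrow> g (pure_tensor scale xs) = h (pure_tensor scale xs)"
    and d: "d \<in> carrier (tensor_power scale m)"
  shows "g d = h d"
  using d
proof (induction d rule: tensor_induct)
  case zero
  show ?case
    by (simp add: module_map_zero[OF module_tensor_power V g] module_map_zero[OF module_tensor_power V h])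
next
  case (pure c xs)
  then show ?case
    using assms(4) by (simp add: module_map_smult[OF g] module_map_smult[OF h] pure_tensor_closed)
next
  case (add x y)
  then show ?case
    by (simp add: module_map_add[OF g] module_map_add[OF h])
qed

lemma multilinear_map2I:
  assumes "\<And>x y. f x y \<in> carrier V"
    and "\<And>x x' y. f (x + x') y = f x y \<oplus>\<^bsub>V\<^esub> f x' y" and "\<And>x y y'. f x (y + y') = f x y \<oplus>\<^bsub>V\<^esub> f x y'"
    and "\<And>c x y. f (scale c x) y = c \<odot>\<^bsub>V\<^esub> f x y" and "\<And>c x y. f x (scale c y) = c \<odot>\<^bsub>V\<^esub> f x y"
  shows "multilinear_map scale 2 V (\<lambda>xs. f (xs ! 0) (xs ! 1))"
  unfolding multilinear_map_def
  using assms by (auto simp: less_2_cases_iff)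

lemma multilinear_map3I:
  assumes "\<And>x y z. f x y z \<in> carrier V"
    and "\<And>x x' y z. f (x + x') y z = f x y z \<oplus>\<^bsub>V\<^esub> f x' y z"
    and "\<And>x y y' z. f x (y + y') z = f x y z \<oplus>\<^bsub>V\<^esub> f x y' z"
    and "\<And>x y z z'. f x y (z + z') = f x y z \<oplus>\<^bsub>V\<^esub> f x y z'"
    and "\<And>c x y z. f (scale c x) y z = c \<odot>\<^bsub>V\<^esub> f x y z"
    and "\<And>c x y z. f x (scale c y) z = c \<odot>\<^bsub>V\<^esub> f x y z"
    and "\<And>c x y z. f x y (scale c z) = c \<odot>\<^bsub>V\<^esub> f x y z"
  shows "multilinear_map scale 3 V (\<lambda>xs. f (xs ! 0) (xs ! 1) (xs ! 2))"
proof -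
  have "i = 0 \<or> i = 1 \<or> i = 2" if "i < 3" for i :: nat
    using that by auto
  then show ?thesis
    unfolding multilinear_map_def using assms by fastforce
qed

lemma multilinear_pure_tensor: "multilinear_map scale m (tensor_power scale m) (pure_tensor scale)"
proof -
  have "tensor_class scale m (Poly_Mapping.single (xs[i := u + v]) 1) =
      tensor_class scale m (Poly_Mapping.single (xs[i := u]) 1 + Poly_Mapping.single (xs[i := v]) 1)"
    if "length xs = m" "i < m" for xs i u v
    unfolding tensor_class_eq_iff using that
    by (intro formal.span_base) (force simp: multilinear_relations_def algebra_simps)
  moreover have "tensor_class scale m (Poly_Mapping.single (xs[i := scale c u]) 1) =
      tensor_class scale m (Poly_Mapping.single (xs[i := u]) c)"
    if "length xs = m" "i < m" for xs i c u
    unfolding tensor_class_eq_iff using that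
    by (intro formal.span_base) (force simp: multilinear_relations_def)
  ultimately show ?thesis
    unfolding multilinear_map_def
    by (auto simp: pure_tensor_closed) (auto simp: pure_tensor_def tensor_add tensor_smult)
qed

lemma pure_tensor2_linear:
  "pure_tensor scale [x + x', y] = pure_tensor scale [x, y] \<oplus>\<^bsub>tensor_power scale 2\<^esub> pure_tensor scale [x', y]"
  "pure_tensor scale [x, y + y'] = pure_tensor scale [x, y] \<oplus>\<^bsub>tensor_power scale 2\<^esub> pure_tensor scale [x, y']"
  "pure_tensor scale [scale c x, y] = c \<odot>\<^bsub>tensor_power scale 2\<^esub> pure_tensor scale [x, y]"
  "pure_tensor scale [x, scale c y] = c \<odot>\<^bsub>tensor_power scale 2\<^esub> pure_tensor scale [x, y]"
proof -
  note ml = multilinear_pure_tensor[of scale 2, unfolded multilinear_map_def]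
  from ml have add: "length xs = 2 \<Longrightarrow> i < 2 \<Longrightarrow> pure_tensor scale (xs[i := u + v]) =
      pure_tensor scale (xs[i := u]) \<oplus>\<^bsub>tensor_power scale 2\<^esub> pure_tensor scale (xs[i := v])" for xs i u v
    by blast
  from ml have smult: "length xs = 2 \<Longrightarrow> i < 2 \<Longrightarrow> pure_tensor scale (xs[i := scale c u]) =
      c \<odot>\<^bsub>tensor_power scale 2\<^esub> pure_tensor scale (xs[i := u])" for xs i c u
    by blast
  show "pure_tensor scale [x + x', y] = pure_tensor scale [x, y] \<oplus>\<^bsub>tensor_power scale 2\<^esub> pure_tensor scale [x', y]"
    "pure_tensor scale [x, y + y'] = pure_tensor scale [x, y] \<oplus>\<^bsub>tensor_power scale 2\<^esub> pure_tensor scale [x, y']"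
    "pure_tensor scale [scale c x, y] = c \<odot>\<^bsub>tensor_power scale 2\<^esub> pure_tensor scale [x, y]"
    "pure_tensor scale [x, scale c y] = c \<odot>\<^bsub>tensor_power scale 2\<^esub> pure_tensor scale [x, y]"
    using add[of "[x, y]" 0] add[of "[x, y]" 1] smult[of "[x, y]" 0] smult[of "[x, y]" 1] by simp_all
qed

lemma pure_tensor3_linear:
  "pure_tensor scale [x + x', y, z] = pure_tensor scale [x, y, z] \<oplus>\<^bsub>tensor_power scale 3\<^esub> pure_tensor scale [x', y, z]"
  "pure_tensor scale [x, y + y', z] = pure_tensor scale [x, y, z] \<oplus>\<^bsub>tensor_power scale 3\<^esub> pure_tensor scale [x, y', z]"
  "pure_tensor scale [x, y, z + z'] = pure_tensor scale [x, y, z] \<oplus>\<^bsub>tensor_power scale 3\<^esub> pure_tensor scale [x, y, z']"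
  "pure_tensor scale [scale c x, y, z] = c \<odot>\<^bsub>tensor_power scale 3\<^esub> pure_tensor scale [x, y, z]"
  "pure_tensor scale [x, scale c y, z] = c \<odot>\<^bsub>tensor_power scale 3\<^esub> pure_tensor scale [x, y, z]"
  "pure_tensor scale [x, y, scale c z] = c \<odot>\<^bsub>tensor_power scale 3\<^esub> pure_tensor scale [x, y, z]"
proof -
  note ml = multilinear_pure_tensor[of scale 3, unfolded multilinear_map_def]
  from ml have add: "length xs = 3 \<Longrightarrow> i < 3 \<Longrightarrow> pure_tensor scale (xs[i := u + v]) =
      pure_tensor scale (xs[i := u]) \<oplus>\<^bsub>tensor_power scale 3\<^esub> pure_tensor scale (xs[i := v])" for xs i u v
    by blast
  from ml have smult: "length xs = 3 \<Longrightarrow> i < 3 \<Longrightarrow> pure_tensor scale (xs[i := scale c u]) =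
      c \<odot>\<^bsub>tensor_power scale 3\<^esub> pure_tensor scale (xs[i := u])" for xs i c u
    by blast
  show "pure_tensor scale [x + x', y, z] = pure_tensor scale [x, y, z] \<oplus>\<^bsub>tensor_power scale 3\<^esub> pure_tensor scale [x', y, z]"
    "pure_tensor scale [x, y + y', z] = pure_tensor scale [x, y, z] \<oplus>\<^bsub>tensor_power scale 3\<^esub> pure_tensor scale [x, y', z]"
    "pure_tensor scale [x, y, z + z'] = pure_tensor scale [x, y, z] \<oplus>\<^bsub>tensor_power scale 3\<^esub> pure_tensor scale [x, y, z']"
    "pure_tensor scale [scale c x, y, z] = c \<odot>\<^bsub>tensor_power scale 3\<^esub> pure_tensor scale [x, y, z]"
    "pure_tensor scale [x, scale c y, z] = c \<odot>\<^bsub>tensor_power scale 3\<^esub> pure_tensor scale [x, y, z]"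
    "pure_tensor scale [x, y, scale c z] = c \<odot>\<^bsub>tensor_power scale 3\<^esub> pure_tensor scale [x, y, z]"
    using add[of "[x, y, z]" 0] add[of "[x, y, z]" 1] add[of "[x, y, z]" 2]
      smult[of "[x, y, z]" 0] smult[of "[x, y, z]" 1] smult[of "[x, y, z]" 2] by simp_all
qed

section \<open>The coordinate ring of the representation scheme\<close>

lemma poly_ring_simps [simp]:
  "carrier poly_ring = UNIV" "monoid.mult poly_ring = (*)" "one poly_ring = 1"
  "zero poly_ring = 0" "add poly_ring = (+)"
  by (simp_all add: poly_ring_def)

lemma cring_poly_ring: "cring (poly_ring :: ('k::field, 'a, 'n) rep_poly ring)"
proof (rule cringI)
  show "abelian_group (poly_ring :: ('k, 'a, 'n) rep_poly ring)"
    by (rule abelian_groupI) (auto simp: algebra_simps intro: exI[of _ "- _"])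
  show "comm_monoid (poly_ring :: ('k, 'a, 'n) rep_poly ring)"
    by unfold_locales (auto simp: algebra_simps)
qed (simp add: algebra_simps)

lemma const_mult: "const (c * d) = const c * const d"
  by (simp add: const_def mult_single)

lemma const_add: "const (c + d) = const c + const d"
  by (simp add: const_def single_add)

lemma const_0 [simp]: "const 0 = 0" and const_1 [simp]: "const 1 = 1"
  by (simp_all add: const_def)

lemma ideal_rep_ideal: "ideal (rep_ideal scale) poly_ring"
  unfolding rep_ideal_def
  by (rule ring.genideal_ideal[OF cring.axioms(1)[OF cring_poly_ring]]) simp

lemma rep_relations_subset: "rep_relations scale \<subseteq> rep_ideal scale"
  unfolding rep_ideal_def
  by (rule ring.genideal_self[OF cring.axioms(1)[OF cring_poly_ring]]) simp

lemma rep_ideal_lincomb: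
  "const r * var a i j + const s * var b i j - var (scale r a + scale s b) i j \<in> rep_ideal scale"
  by (rule subsetD[OF rep_relations_subset]) (unfold rep_relations_def, rule UnI1, rule UnI1, rule CollectI, (rule exI)+, rule conjI, rule refl, rule TrueI)

lemma rep_ideal_one: "var 1 i j - (if i = j then 1 else 0) \<in> rep_ideal scale"
  by (rule subsetD[OF rep_relations_subset]) (unfold rep_relations_def, rule UnI1, rule UnI2, rule CollectI, (rule exI)+, rule conjI, rule refl, rule TrueI)

lemma rep_ideal_prod: "var (a * b) i j - (\<Sum>k\<in>UNIV. var a i k * var b k j) \<in> rep_ideal scale"
  by (rule subsetD[OF rep_relations_subset]) (unfold rep_relations_def, rule UnI2, rule CollectI, (rule exI)+, rule conjI, rule refl, rule TrueI)

lemma rep_ideal_0: "0 \<in> rep_ideal scale"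
  using additive_subgroup.zero_closed[OF ideal.axioms(1)[OF ideal_rep_ideal]] by simp

lemma rep_ideal_add: "p \<in> rep_ideal scale \<Longrightarrow> q \<in> rep_ideal scale \<Longrightarrow> p + q \<in> rep_ideal scale"
  using additive_subgroup.a_closed[OF ideal.axioms(1)[OF ideal_rep_ideal]] by fastforce

lemma rep_ideal_mult: "p \<in> rep_ideal scale \<Longrightarrow> q * p \<in> rep_ideal scale"
  using ideal.I_l_closed[OF ideal_rep_ideal, of p scale q] by simp

lemma rep_ideal_uminus: "p \<in> rep_ideal scale \<Longrightarrow> - p \<in> rep_ideal scale"
  using rep_ideal_mult[of p scale "- 1"] by simp

lemma rep_ideal_diff: "p \<in> rep_ideal scale \<Longrightarrow> q \<in> rep_ideal scale \<Longrightarrow> p - q \<in> rep_ideal scale"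
  using rep_ideal_add[of p scale "- q"] rep_ideal_uminus[of q scale] by simp

text \<open>
  Additive inverses are multiples by \<open>- 1\<close>, so a set with these closure properties is an ideal.
\<close>

lemma rep_ideal_minimal:
  fixes J :: "('k::field, 'a::{ring, monoid_mult}, 'n::finite) rep_poly set"
  assumes sub: "rep_relations scale \<subseteq> J" and "0 \<in> J" and "\<And>p q. p \<in> J \<Longrightarrow> q \<in> J \<Longrightarrow> p + q \<in> J"
    and mult: "\<And>p q. p \<in> J \<Longrightarrow> q * p \<in> J"
  shows "rep_ideal scale \<subseteq> J"
proof -
  interpret cring "poly_ring :: ('k, 'a, 'n) rep_poly ring" by (rule cring_poly_ring)
  have uminus: "- p \<in> J" if "p \<in> J" for p
    using mult[OF that, of "- 1"] by simp
  have "\<ominus>\<^bsub>poly_ring\<^esub> p = - p" for p :: "('k, 'a, 'n) rep_poly"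
    by (rule minus_equality[of "- p" p, simplified])
  with assms uminus have "ideal J poly_ring"
    by (intro idealI ring_axioms add.subgroupI) (auto simp: mult.commute)
  with sub show ?thesis
    unfolding rep_ideal_def by (rule genideal_minimal[rotated])
qed

definition rep_class ::
    "('k::field \<Rightarrow> 'a::{ring, monoid_mult} \<Rightarrow> 'a) \<Rightarrow> ('k, 'a, 'n::finite) rep_poly
     \<Rightarrow> ('k, 'a, 'n) rep_poly set" where
  "rep_class scale p = rep_ideal scale +>\<^bsub>poly_ring\<^esub> p"

lemma mem_rep_class_iff: "q \<in> rep_class scale p \<longleftrightarrow> q - p \<in> rep_ideal scale"
  by (auto simp: rep_class_def a_r_coset_def' intro: bexI[of _ "q - p"])

lemma rep_class_eq_iff: "rep_class scale p = rep_class scale q \<longleftrightarrow> p - q \<in> rep_ideal scale"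
proof
  have "p \<in> rep_class scale p"
    by (simp add: mem_rep_class_iff rep_ideal_0)
  also assume "rep_class scale p = rep_class scale q"
  finally have "p \<in> rep_class scale q" .
  then show "p - q \<in> rep_ideal scale" by (simp add: mem_rep_class_iff)
next
  assume pq: "p - q \<in> rep_ideal scale"
  have "r - p \<in> rep_ideal scale \<longleftrightarrow> r - q \<in> rep_ideal scale" for r
    using rep_ideal_add[OF _ pq, of "r - p"] rep_ideal_diff[OF _ pq, of "r - q"] by auto
  then show "rep_class scale p = rep_class scale q"
    by (auto simp: mem_rep_class_iff)
qed


text \<open>
  The matrix size is a type parameter of the coordinate ring that the scalar multiplication does
  not determine.  Naming the ring \<open>R\<close> fixes this parameter once for all lemmas.
\<close>

locale rep_ring = assoc_algebra scale
  for scale :: "'k::field \<Rightarrow> 'a::{ring, monoid_mult} \<Rightarrow> 'a" +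
  fixes R :: "('k, ('k, 'a, 'n::finite) rep_poly set) module" (structure)
  assumes R_def: "R = rep_algebra scale"
begin

abbreviation cls :: "('k, 'a, 'n) rep_poly \<Rightarrow> ('k, 'a, 'n) rep_poly set" where
  "cls \<equiv> rep_class scale"

lemma rep_carrier: "carrier R = range cls"
  by (auto simp: R_def rep_algebra_def Let_def FactRing_def A_RCOSETS_def' rep_class_def)

lemma cls_closed [simp]: "cls p \<in> carrier R"
  by (simp add: rep_carrier)

lemma rep_carrierE:
  assumes "f \<in> carrier R" obtains p where "f = cls p"
  using assms by (auto simp: rep_carrier)

lemma rep_zero: "\<zero> = cls 0"
  by (simp add: R_def rep_algebra_def Let_def FactRing_def set_eq_iff mem_rep_class_iff)

lemma rep_one: "\<one> = cls 1"
  by (simp add: R_def rep_algebra_def Let_def FactRing_def rep_class_def)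

lemma rep_add: "cls p \<oplus> cls q = cls (p + q)"
  using ideal.a_rcos_sum[OF ideal_rep_ideal, of p q scale]
  by (simp add: R_def rep_algebra_def Let_def FactRing_def rep_class_def)

lemma rep_mult: "cls p \<otimes> cls q = cls (p * q)"
  using ideal.rcoset_mult_add[OF ideal_rep_ideal, of p q scale]
  by (simp add: R_def rep_algebra_def Let_def FactRing_def rep_class_def)

lemma rep_smult: "c \<odot> cls p = cls (const c * p)"
  using ideal.rcoset_mult_add[OF ideal_rep_ideal, of "const c" p scale]
  by (simp add: R_def rep_algebra_def Let_def FactRing_def rep_class_def)

lemmas cls_simps = rep_zero rep_one rep_add rep_mult rep_smult

lemma cring_rep: "cring R"
proof (rule cringI)
  show "abelian_group R"
  proof (rule abelian_groupI)
    fix x assume "x \<in> carrier R"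
    then obtain p where "x = cls p" by (rule rep_carrierE)
    then show "\<exists>y\<in>carrier R. y \<oplus> x = \<zero>"
      by (intro bexI[of _ "cls (- p)"]) (simp_all add: cls_simps)
  qed (auto elim!: rep_carrierE simp: cls_simps add_ac)
  show "comm_monoid R"
    by unfold_locales (auto elim!: rep_carrierE simp: cls_simps mult_ac)
qed (auto elim!: rep_carrierE simp: cls_simps distrib_right)

sublocale A: cring R
  by (rule cring_rep)

lemma algebra_rep: "algebra scalars R"
  by (rule algebraI[OF cring_scalars cring_rep])
    (auto elim!: rep_carrierE simp: cls_simps const_mult const_add distrib_left distrib_right mult.assoc)

sublocale rep: algebra scalars R
  by (rule algebra_rep)

lemmas module_rep = rep.module

lemma rep_uminus: "\<ominus> cls p = cls (- p)"
  by (rule A.minus_equality) (simp_all add: cls_simps)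

lemma rep_finsum:
  assumes "finite A"
  shows "(\<Oplus>i\<in>A. cls (p i)) = cls (\<Sum>i\<in>A. p i)"
  using assms by (induction A rule: finite_induct) (simp_all add: rep_zero[symmetric] rep_add)

lemma rep_smult_closed [simp]: "f \<in> carrier R \<Longrightarrow> c \<odot> f \<in> carrier R"
  using rep.smult_closed by simp

lemma rep_smult_mult_left:
  assumes "f \<in> carrier R" "g \<in> carrier R"
  shows "(c \<odot> f) \<otimes> g = c \<odot> (f \<otimes> g)"
  using rep.smult_assoc2 assms by simp

lemma rep_smult_mult_right:
  assumes "f \<in> carrier R" "g \<in> carrier R"
  shows "f \<otimes> (c \<odot> g) = c \<odot> (f \<otimes> g)"
  using rep_smult_mult_left[OF assms(2,1)] assms by (simp add: A.m_comm)

lemma module_map_mult_left: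
  assumes "g \<in> carrier R"
  shows "module_map R R (\<lambda>f. g \<otimes> f)"
  by (rule module_mapI) (simp_all add: assms A.r_distr rep_smult_mult_right)

lemma module_map_mult_right:
  assumes "g \<in> carrier R"
  shows "module_map R R (\<lambda>f. f \<otimes> g)"
  by (rule module_mapI) (simp_all add: assms A.l_distr rep_smult_mult_left)

definition entry :: "'a \<Rightarrow> 'n \<times> 'n \<Rightarrow> ('k, 'a, 'n) rep_poly set" where
  "entry a u = rep_entry scale a (fst u) (snd u)"

lemma entry_class: "entry a (i, j) = cls (var a i j)"
  by (simp add: entry_def rep_entry_def rep_class_def)

lemma entry_closed [simp]: "entry a u \<in> carrier R"
  by (cases u) (simp add: entry_class)

text \<open>
  The coordinate ring is generated as an algebra by the entries.
\<close>

lemma rep_induct [consumes 1, case_names const entry add mult]: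
  assumes f: "f \<in> carrier R"
    and const: "\<And>c. P (c \<odot> \<one>)" and entry: "\<And>a u. P (entry a u)"
    and add: "\<And>f g. f \<in> carrier R \<Longrightarrow> g \<in> carrier R \<Longrightarrow> P f \<Longrightarrow> P g \<Longrightarrow> P (f \<oplus> g)"
    and mult: "\<And>f g. f \<in> carrier R \<Longrightarrow> g \<in> carrier R \<Longrightarrow> P f \<Longrightarrow> P g \<Longrightarrow> P (f \<otimes> g)"
  shows "P f"
proof -
  have "P (cls p)" for p
  proof (induction p rule: rep_poly_induct)
    case (const c)
    show ?case using assms(2)[of c] by (simp add: cls_simps)
  next
    case (var a i j)
    show ?case using entry[of a "(i, j)"] by (simp add: entry_class)
  next
    case (add p q)
    then show ?case using assms(4)[of "cls p" "cls q"] by (simp add: rep_add)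
  next
    case (mult p q)
    then show ?case using assms(5)[of "cls p" "cls q"] by (simp add: rep_mult)
  qed
  moreover obtain p where "f = cls p" using f by (rule rep_carrierE)
  ultimately show ?thesis by simp
qed

lemma entry_one: "entry 1 (i, j) = (if i = j then \<one> else \<zero>)"
  using rep_ideal_one[of i j scale]
  by (auto simp: entry_class rep_one rep_zero rep_class_eq_iff)

lemma entry_mult: "entry (a * b) (i, j) = (\<Oplus>k\<in>UNIV. entry a (i, k) \<otimes> entry b (k, j))"
  using rep_ideal_prod[of a b i j scale]
  by (simp add: entry_class rep_mult rep_finsum rep_class_eq_iff)

lemma entry_lincomb: "entry (scale r a + scale s b) u = r \<odot> entry a u \<oplus> s \<odot> entry b u"
proof -
  obtain i j where u: "u = (i, j)" by (cases u)
  have "cls (const r * var a i j + const s * var b i j) = cls (var (scale r a + scale s b) i j)"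
    by (simp only: rep_class_eq_iff rep_ideal_lincomb)
  then show ?thesis
    by (simp add: u entry_class cls_simps)
qed

lemma entry_add: "entry (a + b) u = entry a u \<oplus> entry b u"
  using entry_lincomb[of 1 a 1 b u] by (cases u) (simp add: entry_class cls_simps)

lemma entry_scale: "entry (scale c a) u = c \<odot> entry a u"
  using entry_lincomb[of c a 0 a u] by (cases u) (simp add: entry_class cls_simps)

end

section \<open>Evaluating tensors at matrix entries\<close>

context rep_ring
begin

text \<open>
  Evaluation of tensors at matrix positions: \<open>x \<otimes> y\<close> is sent to \<open>x\<^sub>u y\<^sub>v\<close>, and likewise for three factors.
\<close>

definition eval2 :: "'n \<times> 'n \<Rightarrow> 'n \<times> 'n \<Rightarrow> ('a list \<Rightarrow>\<^sub>0 'k) set \<Rightarrow> ('k, 'a, 'n) rep_poly set"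
  where "eval2 u v = tensor_lift R
    (\<lambda>xs. entry (xs ! 0) u \<otimes> entry (xs ! 1) v)"

definition eval3 :: "'n \<times> 'n \<Rightarrow> 'n \<times> 'n \<Rightarrow> 'n \<times> 'n \<Rightarrow> ('a list \<Rightarrow>\<^sub>0 'k) set
    \<Rightarrow> ('k, 'a, 'n) rep_poly set"
  where "eval3 u v w = tensor_lift R
    (\<lambda>xs. entry (xs ! 0) u \<otimes>
      (entry (xs ! 1) v \<otimes> entry (xs ! 2) w))"

lemma multilinear_entry2:
  "multilinear_map scale 2 R
    (\<lambda>xs. entry (xs ! 0) u \<otimes> entry (xs ! 1) v)"
  by (rule multilinear_map2I)
    (simp_all add: entry_add entry_scale A.l_distr A.r_distr rep_smult_mult_left rep_smult_mult_right)

lemma multilinear_entry3: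
  "multilinear_map scale 3 R
    (\<lambda>xs. entry (xs ! 0) u \<otimes>
      (entry (xs ! 1) v \<otimes> entry (xs ! 2) w))"
  by (rule multilinear_map3I)
    (simp_all add: entry_add entry_scale A.l_distr A.r_distr rep_smult_mult_left rep_smult_mult_right)

lemma eval2_map: "module_map (tensor_power scale 2) R (eval2 u v)"
  unfolding eval2_def by (rule tensor_lift_module_map[OF module_rep multilinear_entry2])

lemma eval3_map: "module_map (tensor_power scale 3) R (eval3 u v w)"
  unfolding eval3_def by (rule tensor_lift_module_map[OF module_rep multilinear_entry3])

lemma eval2_pure: "eval2 u v (pure_tensor scale [x, y]) = entry x u \<otimes> entry y v"
  unfolding eval2_def by (subst tensor_lift_pure[OF module_rep multilinear_entry2]) simp_all

lemma eval3_pure: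
  "eval3 u v w (pure_tensor scale [x, y, z]) =
    entry x u \<otimes> (entry y v \<otimes> entry z w)"
  unfolding eval3_def by (subst tensor_lift_pure[OF module_rep multilinear_entry3]) simp_all

lemmas eval2_closed [simp] = module_map_closed[OF eval2_map]
lemmas eval3_closed [simp] = module_map_closed[OF eval3_map]

lemma list2_cases: "length xs = 2 \<Longrightarrow> \<exists>x y. xs = [x, y]"
  by (auto simp: numeral_2_eq_2 length_Suc_conv)

lemma list3_cases: "length xs = 3 \<Longrightarrow> \<exists>x y z. xs = [x, y, z]"
  by (auto simp: numeral_3_eq_3 length_Suc_conv)

text \<open>
  A linear endomorphism of the tensor square given on pure tensors, followed by an evaluation, is
  identified by its values on pure tensors.
\<close>

lemma eval2_lift:
  assumes ml: "multilinear_map scale 2 (tensor_power scale 2) (\<lambda>xs. pure_tensor scale [f xs, g xs])"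
    and W: "module_map (tensor_power scale 2) R h"
    and pure: "\<And>x y. entry (f [x, y]) u \<otimes> entry (g [x, y]) v = h (pure_tensor scale [x, y])"
    and d: "d \<in> carrier (tensor_power scale 2)"
  shows "eval2 u v (tensor_lift (tensor_power scale 2) (\<lambda>xs. pure_tensor scale [f xs, g xs]) d) = h d"
proof (rule module_map_eq_if_eq_on_pure[OF module_rep _ W _ d])
  show "module_map (tensor_power scale 2) R
      (\<lambda>d. eval2 u v (tensor_lift (tensor_power scale 2) (\<lambda>xs. pure_tensor scale [f xs, g xs]) d))"
    by (rule module_map_comp[OF tensor_lift_module_map[OF module_tensor_power ml] eval2_map])
  fix xs :: "'a list" assume "length xs = 2"
  then show "eval2 u v (tensor_lift (tensor_power scale 2) (\<lambda>xs. pure_tensor scale [f xs, g xs])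
      (pure_tensor scale xs)) = h (pure_tensor scale xs)"
    using list2_cases[of xs] by (auto simp: tensor_lift_pure[OF module_tensor_power ml] eval2_pure pure)
qed

text \<open>
  Multiplying the second leg of a tensor by an algebra element becomes a matrix product after
  evaluation.  Together with the next lemma this covers both terms of the Leibniz rule for
  \<open>\<lbrace>bc, a\<rbrace>\<close>.
\<close>

lemma eval2_left_mult_second:
  assumes "d \<in> carrier (tensor_power scale 2)"
  shows "eval2 u (i, j) (tensor_lift (tensor_power scale 2) (\<lambda>xs. pure_tensor scale [xs ! 0, b * xs ! 1]) d)
    = (\<Oplus>m\<in>UNIV. entry b (i, m) \<otimes> eval2 u (m, j) d)"
proof (rule eval2_lift[OF _ _ _ assms])
  show "multilinear_map scale 2 (tensor_power scale 2) (\<lambda>xs. pure_tensor scale [xs ! 0, b * xs ! 1])"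
    by (rule multilinear_map2I)
      (simp_all add: pure_tensor_closed pure_tensor2_linear distrib_left scale_mult_right)
  show "module_map (tensor_power scale 2) R
      (\<lambda>d. \<Oplus>m\<in>UNIV. entry b (i, m) \<otimes> eval2 u (m, j) d)"
    by (intro module_map_finsum module_rep
        module_map_comp[OF eval2_map module_map_mult_left] entry_closed)
  show "entry ([x, y] ! 0) u \<otimes> entry (b * [x, y] ! 1) (i, j) =
      (\<Oplus>m\<in>UNIV. entry b (i, m) \<otimes>
        eval2 u (m, j) (pure_tensor scale [x, y]))" for x y
    by (simp add: eval2_pure entry_mult A.finsum_rdistr A.m_lcomm Pi_def)
qed

lemma eval2_right_mult_second:
  assumes "d \<in> carrier (tensor_power scale 2)"
  shows "eval2 u (i, j) (tensor_lift (tensor_power scale 2) (\<lambda>xs. pure_tensor scale [xs ! 0, xs ! 1 * c]) d)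
    = (\<Oplus>m\<in>UNIV. entry c (m, j) \<otimes> eval2 u (i, m) d)"
proof (rule eval2_lift[OF _ _ _ assms])
  show "multilinear_map scale 2 (tensor_power scale 2) (\<lambda>xs. pure_tensor scale [xs ! 0, xs ! 1 * c])"
    by (rule multilinear_map2I)
      (simp_all add: pure_tensor_closed pure_tensor2_linear distrib_right scale_mult_left)
  show "module_map (tensor_power scale 2) R
      (\<lambda>d. \<Oplus>m\<in>UNIV. entry c (m, j) \<otimes> eval2 u (i, m) d)"
    by (intro module_map_finsum module_rep
        module_map_comp[OF eval2_map module_map_mult_left] entry_closed)
  show "entry ([x, y] ! 0) u \<otimes> entry ([x, y] ! 1 * c) (i, j) =
      (\<Oplus>m\<in>UNIV. entry c (m, j) \<otimes>
        eval2 u (i, m) (pure_tensor scale [x, y]))" for x y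
    by (simp add: eval2_pure entry_mult A.finsum_rdistr A.m_ac Pi_def)
qed

lemma multilinear_opposite:
  "multilinear_map scale 2 (tensor_power scale 2) (\<lambda>xs. pure_tensor scale [xs ! 1, xs ! 0])"
  using multilinear_map2I[of "\<lambda>x y. pure_tensor scale [y, x]" "tensor_power scale 2" scale]
  by (simp add: pure_tensor_closed pure_tensor2_linear)

lemma tensor_opposite_map: "module_map (tensor_power scale 2) (tensor_power scale 2) (tensor_opposite scale)"
  unfolding tensor_opposite_def
  by (rule tensor_lift_module_map[OF module_tensor_power multilinear_opposite])

lemma tensor_opposite_pure: "tensor_opposite scale (pure_tensor scale [x, y]) = pure_tensor scale [y, x]"
  unfolding tensor_opposite_def
  by (subst tensor_lift_pure[OF module_tensor_power multilinear_opposite]) simp_all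

lemma eval2_opposite:
  assumes "d \<in> carrier (tensor_power scale 2)"
  shows "eval2 u v (tensor_opposite scale d) = eval2 v u d"
  unfolding tensor_opposite_def
proof (rule eval2_lift[OF multilinear_opposite eval2_map _ assms])
  show "entry ([x, y] ! 1) u \<otimes> entry ([x, y] ! 0) v
      = eval2 v u (pure_tensor scale [x, y])" for x y
    by (simp add: eval2_pure A.m_comm)
qed

lemma multilinear_append:
  "multilinear_map scale 2 (tensor_power scale 3) (\<lambda>xs. pure_tensor scale [xs ! 0, xs ! 1, y])"
  by (rule multilinear_map2I) (simp_all add: pure_tensor_closed pure_tensor3_linear)

lemma tensor_append_map:
  "module_map (tensor_power scale 2) (tensor_power scale 3) (\<lambda>d. tensor_append scale d y)"
  unfolding tensor_append_def
  by (rule tensor_lift_module_map[OF module_tensor_power multilinear_append])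

lemma tensor_append_pure: "tensor_append scale (pure_tensor scale [x, x']) y = pure_tensor scale [x, x', y]"
  unfolding tensor_append_def
  by (subst tensor_lift_pure[OF module_tensor_power multilinear_append]) simp_all

lemma tensor_append_add:
  assumes "d \<in> carrier (tensor_power scale 2)"
  shows "tensor_append scale d (y + y') =
    tensor_append scale d y \<oplus>\<^bsub>tensor_power scale 3\<^esub> tensor_append scale d y'"
  by (rule module_map_eq_if_eq_on_pure[OF module_tensor_power tensor_append_map
        module_map_plus[OF module_tensor_power tensor_append_map tensor_append_map] _ assms])
    (auto dest!: list2_cases simp: tensor_append_pure pure_tensor3_linear)

lemma tensor_append_scale:
  assumes "d \<in> carrier (tensor_power scale 2)"
  shows "tensor_append scale d (scale c y) = c \<odot>\<^bsub>tensor_power scale 3\<^esub> tensor_append scale d y"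
proof (rule module_map_eq_if_eq_on_pure[OF module_tensor_power tensor_append_map _ _ assms])
  interpret T: Module.module scalars "tensor_power scale 3" by (rule module_tensor_power)
  show "module_map (tensor_power scale 2) (tensor_power scale 3)
      (\<lambda>d. c \<odot>\<^bsub>tensor_power scale 3\<^esub> tensor_append scale d y)"
  proof (rule module_mapI)
    fix x r assume x: "x \<in> carrier (tensor_power scale 2)"
    note closed = module_map_closed[OF tensor_append_map[of y]]
    show "c \<odot>\<^bsub>tensor_power scale 3\<^esub> tensor_append scale x y \<in> carrier (tensor_power scale 3)"
      using closed[OF x] T.smult_closed by simp
    show "c \<odot>\<^bsub>tensor_power scale 3\<^esub> tensor_append scale (r \<odot>\<^bsub>tensor_power scale 2\<^esub> x) y =
        r \<odot>\<^bsub>tensor_power scale 3\<^esub> (c \<odot>\<^bsub>tensor_power scale 3\<^esub> tensor_append scale x y)"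
      using closed[OF x] T.smult_assoc1[of c r] T.smult_assoc1[of r c]
      by (simp add: module_map_smult[OF tensor_append_map x] mult.commute)
    fix x' assume x': "x' \<in> carrier (tensor_power scale 2)"
    show "c \<odot>\<^bsub>tensor_power scale 3\<^esub> tensor_append scale (x \<oplus>\<^bsub>tensor_power scale 2\<^esub> x') y =
        c \<odot>\<^bsub>tensor_power scale 3\<^esub> tensor_append scale x y
        \<oplus>\<^bsub>tensor_power scale 3\<^esub> c \<odot>\<^bsub>tensor_power scale 3\<^esub> tensor_append scale x' y"
      using closed[OF x] closed[OF x'] T.smult_r_distr
      by (simp add: module_map_add[OF tensor_append_map x x'])
  qed
qed (auto dest!: list2_cases simp: tensor_append_pure pure_tensor3_linear)

lemma eval3_append:
  assumes "d \<in> carrier (tensor_power scale 2)"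
  shows "eval3 u v w (tensor_append scale d y) = eval2 u v d \<otimes> entry y w"
proof (rule module_map_eq_if_eq_on_pure[OF module_rep _ _ _ assms])
  show "module_map (tensor_power scale 2) R (\<lambda>d. eval3 u v w (tensor_append scale d y))"
    by (rule module_map_comp[OF tensor_append_map eval3_map])
  show "module_map (tensor_power scale 2) R
      (\<lambda>d. eval2 u v d \<otimes> entry y w)"
    by (rule module_map_comp[OF eval2_map module_map_mult_right]) simp
  show "eval3 u v w (tensor_append scale (pure_tensor scale xs) y) =
      eval2 u v (pure_tensor scale xs) \<otimes> entry y w" if "length xs = 2" for xs
    using list2_cases[OF that] by (auto simp: tensor_append_pure eval2_pure eval3_pure A.m_assoc)
qed

text \<open>
  The permutations act on pure tensors of degree three by a rearrangement \<open>f\<close> of the entries.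
  Working with \<open>f\<close> separates the computation of inverse permutations from linear algebra.
\<close>

lemma tensor_permute_rearrange:
  fixes f :: "'a \<Rightarrow> 'a \<Rightarrow> 'a \<Rightarrow> 'a list"
  assumes ml: "multilinear_map scale 3 (tensor_power scale 3) (\<lambda>xs. pure_tensor scale (f (xs ! 0) (xs ! 1) (xs ! 2)))"
    and perm: "\<And>x y z. permute_list (inv_into UNIV \<sigma>) [x, y, z] = f x y z"
  shows "module_map (tensor_power scale 3) (tensor_power scale 3) (tensor_permute scale 3 \<sigma>)"
    and "tensor_permute scale 3 \<sigma> (pure_tensor scale [x, y, z]) = pure_tensor scale (f x y z)"
proof -
  have ml': "multilinear_map scale 3 (tensor_power scale 3)
      (\<lambda>xs. pure_tensor scale (permute_list (inv_into UNIV \<sigma>) xs))"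
    using ml by (rule multilinear_map_cong) (auto dest!: list3_cases simp: perm)
  show "module_map (tensor_power scale 3) (tensor_power scale 3) (tensor_permute scale 3 \<sigma>)"
    unfolding tensor_permute_def by (rule tensor_lift_module_map[OF module_tensor_power ml'])
  show "tensor_permute scale 3 \<sigma> (pure_tensor scale [x, y, z]) = pure_tensor scale (f x y z)"
    unfolding tensor_permute_def
    by (subst tensor_lift_pure[OF module_tensor_power ml']) (simp_all add: perm)
qed

lemma cycle_inverses:
  "inv_into UNIV (cycle_of_list [0, 1, 2 :: nat]) = cycle_of_list [0, 2, 1]"
  "inv_into UNIV (cycle_of_list [0, 2, 1 :: nat]) = cycle_of_list [0, 1, 2]"
  "inv_into UNIV (cycle_of_list [0, 1 :: nat]) = cycle_of_list [0, 1]"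
  by (rule inv_unique_comp; auto simp: fun_eq_iff transpose_def)+

lemma permute_cycles:
  "permute_list (inv_into UNIV (cycle_of_list [0, 1, 2])) [x, y, z] = [z, x, y]"
  "permute_list (inv_into UNIV (cycle_of_list [0, 2, 1])) [x, y, z] = [y, z, x]"
  "permute_list (inv_into UNIV (cycle_of_list [0, 1])) [x, y, z] = [y, x, z]"
  unfolding cycle_inverses
  by (simp_all add: permute_list_def transpose_def upt_rec numeral_2_eq_2)

lemma multilinear_permuted:
  "multilinear_map scale 3 (tensor_power scale 3) (\<lambda>xs. pure_tensor scale [xs ! 2, xs ! 0, xs ! 1])"
  "multilinear_map scale 3 (tensor_power scale 3) (\<lambda>xs. pure_tensor scale [xs ! 1, xs ! 2, xs ! 0])"
  "multilinear_map scale 3 (tensor_power scale 3) (\<lambda>xs. pure_tensor scale [xs ! 1, xs ! 0, xs ! 2])"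
  using multilinear_map3I[of "\<lambda>x y z. pure_tensor scale [z, x, y]" "tensor_power scale 3" scale]
    multilinear_map3I[of "\<lambda>x y z. pure_tensor scale [y, z, x]" "tensor_power scale 3" scale]
    multilinear_map3I[of "\<lambda>x y z. pure_tensor scale [y, x, z]" "tensor_power scale 3" scale]
  by (simp_all add: pure_tensor_closed pure_tensor3_linear)

lemma eval3_permute_rearrange:
  fixes f :: "'a \<Rightarrow> 'a \<Rightarrow> 'a \<Rightarrow> 'a list"
  assumes ml: "multilinear_map scale 3 (tensor_power scale 3) (\<lambda>xs. pure_tensor scale (f (xs ! 0) (xs ! 1) (xs ! 2)))"
    and perm: "\<And>x y z. permute_list (inv_into UNIV \<sigma>) [x, y, z] = f x y z"
    and eval: "\<And>x y z. eval3 u v w (pure_tensor scale (f x y z)) = eval3 u' v' w' (pure_tensor scale [x, y, z])"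
    and t: "t \<in> carrier (tensor_power scale 3)"
  shows "eval3 u v w (tensor_permute scale 3 \<sigma> t) = eval3 u' v' w' t"
proof (rule module_map_eq_if_eq_on_pure[OF module_rep
      module_map_comp[OF tensor_permute_rearrange(1)[OF ml perm] eval3_map] eval3_map _ t])
  fix xs :: "'a list" assume "length xs = 3"
  then obtain x y z where xs: "xs = [x, y, z]" using list3_cases by blast
  show "eval3 u v w (tensor_permute scale 3 \<sigma> (pure_tensor scale xs)) = eval3 u' v' w' (pure_tensor scale xs)"
    unfolding xs tensor_permute_rearrange(2)[OF ml perm] by (rule eval)
qed

text \<open>
  The coordinate ring is commutative, so permuting tensor factors only permutes the positions of
  evaluation.
\<close>

lemma eval3_permute:
  assumes t: "t \<in> carrier (tensor_power scale 3)"
  shows "eval3 u v w (tensor_permute scale 3 (cycle_of_list [0, 1, 2]) t) = eval3 v w u t"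
    and "eval3 u v w (tensor_permute scale 3 (cycle_of_list [0, 2, 1]) t) = eval3 w u v t"
    and "eval3 u v w (tensor_permute scale 3 (cycle_of_list [0, 1]) t) = eval3 v u w t"
proof -
  show "eval3 u v w (tensor_permute scale 3 (cycle_of_list [0, 1, 2]) t) = eval3 v w u t"
    by (rule eval3_permute_rearrange[OF multilinear_permuted(1) permute_cycles(1) _ t])
      (simp add: eval3_pure A.m_ac)
  show "eval3 u v w (tensor_permute scale 3 (cycle_of_list [0, 2, 1]) t) = eval3 w u v t"
    by (rule eval3_permute_rearrange[OF multilinear_permuted(2) permute_cycles(2) _ t])
      (simp add: eval3_pure A.m_ac)
  show "eval3 u v w (tensor_permute scale 3 (cycle_of_list [0, 1]) t) = eval3 v u w t"
    by (rule eval3_permute_rearrange[OF multilinear_permuted(3) permute_cycles(3) _ t])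
      (simp add: eval3_pure A.m_ac)
qed

end

section \<open>The induced bracket\<close>

definition derivation :: "('k::field, 'r, 'z) module_scheme \<Rightarrow> ('r \<Rightarrow> 'r) \<Rightarrow> bool" where
  "derivation R D \<longleftrightarrow> module_map R R D \<and>
     (\<forall>f\<in>carrier R. \<forall>g\<in>carrier R. D (f \<otimes>\<^bsub>R\<^esub> g) = f \<otimes>\<^bsub>R\<^esub> D g \<oplus>\<^bsub>R\<^esub> D f \<otimes>\<^bsub>R\<^esub> g)"

lemma derivation_map: "derivation R D \<Longrightarrow> module_map R R D"
  and derivation_mult: "derivation R D \<Longrightarrow> f \<in> carrier R \<Longrightarrow> g \<in> carrier R \<Longrightarrow>
    D (f \<otimes>\<^bsub>R\<^esub> g) = f \<otimes>\<^bsub>R\<^esub> D g \<oplus>\<^bsub>R\<^esub> D f \<otimes>\<^bsub>R\<^esub> g"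
  by (auto simp: derivation_def)

lemma (in antisymmetric_biderivation) bracket_in_carrier:
  "f \<in> carrier R \<Longrightarrow> g \<in> carrier R \<Longrightarrow> B f g \<in> carrier R"
  using bracket_closed by auto

lemma (in antisymmetric_biderivation) derivation_bracket_left:
  "g \<in> carrier R \<Longrightarrow> derivation R (\<lambda>f. B f g)"
  by (simp add: derivation_def bracket_mult_left)
    (rule module_mapI; simp add: bracket_in_carrier bracket_add_left bracket_smult_left)

lemma (in antisymmetric_biderivation) derivation_bracket_right:
  "f \<in> carrier R \<Longrightarrow> derivation R (B f)"
  by (simp add: derivation_def bracket_mult_right)
    (rule module_mapI; simp add: bracket_in_carrier bracket_add_right bracket_smult_right)

lemma module_map_finsum_apply:
  fixes V :: "('k::field, 'v, 'y) module_scheme"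
  assumes V: "Module.module scalars V" and W: "Module.module scalars W"
    and h: "module_map V W h" and "finite A" and "f \<in> A \<rightarrow> carrier V"
  shows "h (\<Oplus>\<^bsub>V\<^esub>i\<in>A. f i) = (\<Oplus>\<^bsub>W\<^esub>i\<in>A. h (f i))"
  using assms(4,5)
proof (induction A rule: finite_induct)
  interpret V: Module.module scalars V by (rule V)
  interpret W: Module.module scalars W by (rule W)
  {
    case empty
    show ?case by (simp add: module_map_zero[OF V W h])
  next
    case (insert i A)
    then have "f i \<in> carrier V" "f \<in> A \<rightarrow> carrier V" by auto
    then show ?case
      using insert by (simp add: module_map_add[OF h] module_map_closed[OF h] Pi_def)
  }
qed

context rep_ring
begin

lemma derivation_one:
  assumes D: "derivation R D"
  shows "D \<one> = \<zero>"
proof -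
  have closed: "D \<one> \<in> carrier R"
    by (rule module_map_closed[OF derivation_map[OF D]]) simp
  have "D (\<one> \<otimes> \<one>) = \<one> \<otimes> D \<one> \<oplus> D \<one> \<otimes> \<one>"
    by (rule derivation_mult[OF D]) simp_all
  then show ?thesis
    using closed by simp
qed

text \<open>
  The set where two derivations agree is a subalgebra, and the entries generate the whole ring.
\<close>

lemma derivation_eqI:
  assumes D: "derivation R D" and D': "derivation R D'"
    and entries: "\<And>a u. D (entry a u) = D' (entry a u)" and f: "f \<in> carrier R"
  shows "D f = D' f"
  using f
proof (induction f rule: rep_induct)
  case (const c)
  have "D (c \<odot> \<one>) = c \<odot> D \<one>" "D' (c \<odot> \<one>) = c \<odot> D' \<one>"
    by (simp_all add: module_map_smult[OF derivation_map[OF D]] module_map_smult[OF derivation_map[OF D']])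
  then show ?case by (simp add: derivation_one[OF D] derivation_one[OF D'])
next
  case (add f g)
  then show ?case by (simp add: module_map_add[OF derivation_map[OF D]] module_map_add[OF derivation_map[OF D']])
next
  case (mult f g)
  then show ?case by (simp add: derivation_mult[OF D] derivation_mult[OF D'])
qed (rule entries)

lemma derivation_zero: "derivation R (\<lambda>f. \<zero>)"
  using rep.smult_r_null by (auto simp: derivation_def intro!: module_mapI)

text \<open>
  The previous lemma is used in the first argument for entries on the right, then in the second
  argument.  Both brackets are undefined outside the carrier, hence equal as functions.
\<close>

lemma biderivation_eqI:
  assumes B: "antisymmetric_biderivation R B" and B': "antisymmetric_biderivation R B'"
    and entries: "\<And>a u b v. B (entry a u) (entry b v) = B' (entry a u) (entry b v)"
  shows "B = B'"
proof -
  interpret B: antisymmetric_biderivation R B by (rule B)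
  interpret B': antisymmetric_biderivation R B' by (rule B')
  have entry_right: "B f (entry b v) = B' f (entry b v)" if "f \<in> carrier R" for f b v
    by (rule derivation_eqI[OF B.derivation_bracket_left B'.derivation_bracket_left _ that])
      (simp_all add: entries)
  have agree: "B f g = B' f g" if "f \<in> carrier R" "g \<in> carrier R" for f g
    by (rule derivation_eqI[OF B.derivation_bracket_right B'.derivation_bracket_right _ that(2)])
      (simp_all add: entry_right that)
  show ?thesis
  proof
    fix f
    show "B f = B' f"
    proof (cases "f \<in> carrier R")
      case True
      then have ext: "B f \<in> extensional (carrier R)" "B' f \<in> extensional (carrier R)"
        using B.bracket_closed B'.bracket_closed by (auto simp: PiE_def Pi_def)
      show ?thesis
        by (rule extensionalityI[OF ext]) (rule agree[OF True])
    next
      case False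
      have "B \<in> extensional (carrier R)" "B' \<in> extensional (carrier R)"
        using B.bracket_closed B'.bracket_closed by (auto simp: PiE_def)
      then show ?thesis using False by (simp add: extensional_def)
    qed
  qed
qed

text \<open>
  The bookkeeping in the next lemma: the mixed products of first brackets cancel in pairs.  The
  equation is a polynomial identity, verified on representatives.
\<close>

lemma jacobiator_leibniz_identity:
  assumes "f \<in> carrier R" "f' \<in> carrier R" "X \<in> carrier R" "X' \<in> carrier R" "Y \<in> carrier R"
    "Y' \<in> carrier R" "Z \<in> carrier R" "Z' \<in> carrier R" "P \<in> carrier R" "P' \<in> carrier R"
    "Q \<in> carrier R" "Q' \<in> carrier R"
  shows "(f \<otimes> X' \<oplus> X \<otimes> f')
      \<oplus> ((f \<otimes> Y' \<oplus> \<ominus> Q \<otimes> P') \<oplus> (P \<otimes> \<ominus> Q' \<oplus> Y \<otimes> f'))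
      \<oplus> ((f \<otimes> Z' \<oplus> P \<otimes> Q') \<oplus> (Q \<otimes> P' \<oplus> Z \<otimes> f'))
    = f \<otimes> (X' \<oplus> Y' \<oplus> Z') \<oplus> (X \<oplus> Y \<oplus> Z) \<otimes> f'"
  using assms by (elim rep_carrierE) (simp add: cls_simps rep_uminus algebra_simps)

text \<open>
  When one argument is a product \<open>f f'\<close>, the double brackets produce mixed terms such as
  \<open>{f, g} {h, f'}\<close>, and by antisymmetry those from the second summand cancel those from the third.
\<close>

lemma derivation_jacobiator:
  assumes B: "antisymmetric_biderivation R B" and g: "g \<in> carrier R" and h: "h \<in> carrier R"
  shows "derivation R (\<lambda>f. B f (B g h) \<oplus> B g (B h f) \<oplus> B h (B f g))"
proof -
  interpret B: antisymmetric_biderivation R B by (rule B)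
  have bracket_map: "module_map R R (B f)" "module_map R R (\<lambda>x. B x f)" if "f \<in> carrier R" for f
    using B.derivation_bracket_left[OF that] B.derivation_bracket_right[OF that]
    by (simp_all add: derivation_def)
  have linear: "module_map R R (\<lambda>f. B f (B g h) \<oplus> B g (B h f) \<oplus> B h (B f g))"
    by (intro module_map_plus module_rep module_map_comp[of R R "\<lambda>f. B f g" R "B h"]
        module_map_comp[of R R "B h" R "B g"] bracket_map g h B.bracket_in_carrier)
  note closed = B.bracket_in_carrier
  have leibniz: "B (f \<otimes> f') (B g h) \<oplus> B g (B h (f \<otimes> f')) \<oplus> B h (B (f \<otimes> f') g) =
      f \<otimes> (B f' (B g h) \<oplus> B g (B h f') \<oplus> B h (B f' g))
      \<oplus> (B f (B g h) \<oplus> B g (B h f) \<oplus> B h (B f g)) \<otimes> f'"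
    if f: "f \<in> carrier R" and f': "f' \<in> carrier R" for f f'
  proof -
    have "B g (B h (f \<otimes> f')) = (f \<otimes> B g (B h f') \<oplus> B g f \<otimes> B h f')
        \<oplus> (B h f \<otimes> B g f' \<oplus> B g (B h f) \<otimes> f')"
      using f f' g h
      by (simp add: B.bracket_mult_right B.bracket_add_right closed)
    moreover have "B g f = \<ominus> B f g" "B g f' = \<ominus> B f' g"
      by (rule B.bracket_antisym[OF g f], rule B.bracket_antisym[OF g f'])
    ultimately have right: "B g (B h (f \<otimes> f')) = (f \<otimes> B g (B h f') \<oplus> \<ominus> B f g \<otimes> B h f')
        \<oplus> (B h f \<otimes> \<ominus> B f' g \<oplus> B g (B h f) \<otimes> f')"
      by simp
    have left: "B h (B (f \<otimes> f') g) = (f \<otimes> B h (B f' g) \<oplus> B h f \<otimes> B f' g)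
        \<oplus> (B f g \<otimes> B h f' \<oplus> B h (B f g) \<otimes> f')"
      using f f' g h
      by (simp add: B.bracket_mult_right B.bracket_mult_left B.bracket_add_right closed)
    show ?thesis
      unfolding left right B.bracket_mult_left[OF f f' closed[OF g h]]
      by (rule jacobiator_leibniz_identity; intro closed f f' g h)
  qed
  show ?thesis
    using linear leibniz by (simp add: derivation_def)
qed

lemma rotate_sum3:
  assumes "X \<in> carrier R" "Y \<in> carrier R" "Z \<in> carrier R"
  shows "X \<oplus> Y \<oplus> Z = Y \<oplus> Z \<oplus> X"
  using assms by (simp add: A.a_ac)

text \<open>
  The Jacobiator is invariant under cyclic rotation, so being a derivation in the first argument
  is enough: the arguments are made arbitrary one at a time, rotating in between.
\<close>

lemma poisson_if_jacobi_on_entries: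
  assumes B: "antisymmetric_biderivation R B"
    and jacobi: "\<And>a u b v c w. B (entry a u) (B (entry b v) (entry c w))
      \<oplus> B (entry b v) (B (entry c w) (entry a u)) \<oplus> B (entry c w) (B (entry a u) (entry b v)) = \<zero>"
  shows "poisson_bracket R B"
proof -
  interpret B: antisymmetric_biderivation R B by (rule B)
  note closed = B.bracket_in_carrier
  define J where "J f g h = B f (B g h) \<oplus> B g (B h f) \<oplus> B h (B f g)" for f g h
  have rotate: "J f g h = J g h f" if "f \<in> carrier R" "g \<in> carrier R" "h \<in> carrier R" for f g h
    unfolding J_def by (rule rotate_sum3) (intro closed that)+
  have vanish: "J f g h = \<zero>"
    if "\<And>a u. J (entry a u) g h = \<zero>" "f \<in> carrier R" "g \<in> carrier R" "h \<in> carrier R" for f g h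
    using derivation_eqI[OF derivation_jacobiator[OF B that(3,4)] derivation_zero] that
    by (simp add: J_def)
  have step1: "J f (entry b v) (entry c w) = \<zero>" if "f \<in> carrier R" for f b v c w
    by (rule vanish) (simp_all add: that jacobi J_def)
  have step2: "J g (entry c w) f = \<zero>" if "f \<in> carrier R" "g \<in> carrier R" for f g c w
  proof (rule vanish)
    show "J (entry b v) (entry c w) f = \<zero>" for b v
      using rotate[of f "entry b v" "entry c w"] step1[of f b v c w] that by simp
  qed (simp_all add: that)
  have "J h f g = \<zero>" if "f \<in> carrier R" "g \<in> carrier R" "h \<in> carrier R" for f g h
  proof (rule vanish)
    show "J (entry c w) f g = \<zero>" for c w
      using rotate[of g "entry c w" f] step2[of f g c w] that by simp
  qed (simp_all add: that)
  then show ?thesis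
    by unfold_locales (simp add: J_def)
qed

end

text \<open>
  A double bracket together with the coordinate ring of the representation scheme of its algebra.
\<close>

locale double_bracket_rep = rep_ring scale R + double_bracket scale db
  for scale :: "'k::field \<Rightarrow> 'a::{ring, monoid_mult} \<Rightarrow> 'a"
    and R :: "('k, ('k, 'a, 'n::finite) rep_poly set) module" (structure)
    and db :: "'a \<Rightarrow> 'a \<Rightarrow> ('a list \<Rightarrow>\<^sub>0 'k) set"
begin

lemma eval2_db_closed [simp]: "eval2 u v (db a b) \<in> carrier R"
  by (simp add: db_closed)

lemma smult_db_closed: "r \<odot>\<^bsub>tensor_power scale 2\<^esub> db a b \<in> carrier (tensor_power scale 2)"
  using db_closed[of "scale r a" b] by (simp only: db_scale_left)

lemma eval2_db_lincomb:
  "eval2 u v (db (scale r a + scale s b) c) = r \<odot> eval2 u v (db a c) \<oplus> s \<odot> eval2 u v (db b c)"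
  by (simp add: db_add_left db_scale_left module_map_add[OF eval2_map] module_map_smult[OF eval2_map]
      db_closed smult_db_closed)

lemma tensor_opposite_db: "tensor_opposite scale (db a b) = \<ominus>\<^bsub>tensor_power scale 2\<^esub> db b a"
proof -
  interpret T: Module.module scalars "tensor_power scale 2" by (rule module_tensor_power)
  show ?thesis
    unfolding db_antisym[of b a]
    by (rule T.M.minus_minus[symmetric]) (rule module_map_closed[OF tensor_opposite_map db_closed])
qed

lemma eval2_db_antisym: "eval2 u v (db a b) = \<ominus> eval2 v u (db b a)"
proof -
  have "\<ominus> eval2 v u (db b a) = \<ominus> eval2 u v (tensor_opposite scale (db b a))"
    by (simp only: eval2_opposite[OF db_closed])
  also have "\<dots> = \<ominus> (\<ominus> eval2 u v (db a b))"
    by (simp only: tensor_opposite_db module_map_uminus[OF module_tensor_power module_rep eval2_map db_closed])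
  also have "\<dots> = eval2 u v (db a b)"
    by (rule A.minus_minus) simp
  finally show ?thesis ..
qed

lemma eval2_db_mult_left:
  "eval2 u (i, j) (db (b * c) a) = (\<Oplus>m\<in>UNIV. entry b (i, m) \<otimes> eval2 u (m, j) (db c a))
    \<oplus> (\<Oplus>m\<in>UNIV. entry c (m, j) \<otimes> eval2 u (i, m) (db b a))"
proof -
  have ml: "multilinear_map scale 2 (tensor_power scale 2) (\<lambda>xs. pure_tensor scale [xs ! 0, b * xs ! 1])"
    "multilinear_map scale 2 (tensor_power scale 2) (\<lambda>xs. pure_tensor scale [xs ! 0, xs ! 1 * c])"
    by (rule multilinear_map2I; simp add: pure_tensor_closed pure_tensor2_linear distrib_left
        distrib_right scale_mult_right scale_mult_left)+
  note closed = ml[THEN tensor_lift_module_map[OF module_tensor_power], THEN module_map_closed, OF db_closed]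
  show ?thesis
    unfolding db_mult_left module_map_add[OF eval2_map closed]
    by (simp only: eval2_left_mult_second[OF db_closed] eval2_right_mult_second[OF db_closed])
qed

text \<open>
  The Leibniz rule for \<open>1 = 1 \<cdot> 1\<close> shows that the value equals its double.
\<close>

lemma eval2_db_one: "eval2 u v (db 1 a) = \<zero>"
proof -
  obtain i j where v: "v = (i, j)" by (cases v)
  have "entry 1 (i, m) \<otimes> eval2 u (m, j) (db 1 a) = (if i = m then eval2 u (m, j) (db 1 a) else \<zero>)" for m
    by (simp add: entry_one)
  then have left: "(\<Oplus>m\<in>UNIV. entry 1 (i, m) \<otimes> eval2 u (m, j) (db 1 a)) = eval2 u (i, j) (db 1 a)"
    using A.add.finprod_singleton[of i UNIV "\<lambda>m. eval2 u (m, j) (db 1 a)"] by simp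
  have "entry 1 (m, j) \<otimes> eval2 u (i, m) (db 1 a) = (if j = m then eval2 u (i, m) (db 1 a) else \<zero>)" for m
    by (auto simp: entry_one)
  then have right: "(\<Oplus>m\<in>UNIV. entry 1 (m, j) \<otimes> eval2 u (i, m) (db 1 a)) = eval2 u (i, j) (db 1 a)"
    using A.add.finprod_singleton[of j UNIV "\<lambda>m. eval2 u (i, m) (db 1 a)"] by simp
  have "eval2 u v (db 1 a) \<oplus> eval2 u v (db 1 a) = eval2 u v (db 1 a)"
    using eval2_db_mult_left[of u i j 1 1 a] unfolding left right mult_1_left v by (rule sym)
  then show ?thesis
    using A.add.r_cancel_one[of "eval2 u v (db 1 a)" "eval2 u v (db 1 a)"] by simp
qed

end

context double_bracket_rep
begin

text \<open>
  A polynomial representing the prescribed bracket of two variables.  Antisymmetry of the choice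
  is available only modulo the ideal.
\<close>

definition entry_bracket ::
    "'a \<times> 'n \<times> 'n \<Rightarrow> 'a \<times> 'n \<times> 'n \<Rightarrow> ('k, 'a, 'n) rep_poly" where
  "entry_bracket x y = (SOME p. cls p = eval2 (snd y) (snd x) (db (fst x) (fst y)))"

lemma cls_entry_bracket: "cls (entry_bracket (a, u) (b, v)) = eval2 v u (db a b)"
proof -
  obtain p where "eval2 v u (db a b) = cls p"
    by (rule rep_carrierE[OF eval2_db_closed])
  then have "cls (SOME p. cls p = eval2 v u (db a b)) = eval2 v u (db a b)"
    by (rule someI[where P = "\<lambda>p. cls p = eval2 v u (db a b)", OF sym])
  then show ?thesis
    by (simp add: entry_bracket_def)
qed

abbreviation poly_bracket :: "('k, 'a, 'n) rep_poly \<Rightarrow> ('k, 'a, 'n) rep_poly \<Rightarrow> ('k, 'a, 'n) rep_poly"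
  where "poly_bracket \<equiv> bideriv_ext entry_bracket"

lemma cls_eq_zero_iff: "cls p = \<zero> \<longleftrightarrow> p \<in> rep_ideal scale"
  by (simp add: rep_zero rep_class_eq_iff)

text \<open>
  For each kind of relation the bracket with a variable is an evaluated law of the double bracket:
  linearity, the vanishing at \<open>1\<close>, and the Leibniz rule in the first argument.
\<close>

lemma poly_bracket_relation_var:
  assumes "p \<in> rep_relations scale"
  shows "poly_bracket p (var c k l) \<in> rep_ideal scale"
proof -
  define w where "w = (k, l)"
  have bracket_var: "cls (poly_bracket (var a i j) (var c k l)) = eval2 w (i, j) (db a c)" for a i j
    by (simp add: cls_entry_bracket w_def)
  from assms have "cls (poly_bracket p (var c k l)) = \<zero>"
    unfolding rep_relations_def
  proof (elim UnE CollectE exE conjE)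
    fix r s a b i j
    assume lincomb: "p = const r * var a i j + const s * var b i j - var (scale r a + scale s b) i j"
    have "cls (const r * poly_bracket (var a i j) (var c k l)
        + const s * poly_bracket (var b i j) (var c k l))
      = cls (poly_bracket (var (scale r a + scale s b) i j) (var c k l))"
      unfolding bracket_var eval2_db_lincomb
      by (simp only: bracket_var flip: rep_add rep_smult)
    then show ?thesis
      by (simp add: lincomb bideriv_ext_add_left bideriv_ext_diff_left bideriv_ext_mult_left
          cls_eq_zero_iff rep_class_eq_iff del: bideriv_ext_var)
  next
    fix i j
    assume one: "p = var 1 i j - (if i = j then 1 else 0)"
    have "poly_bracket (if i = j then 1 else 0) (var c k l) = 0"
      using bideriv_ext_const_left[of entry_bracket 1] by simp
    then show ?thesis
      by (simp add: one bideriv_ext_diff_left bracket_var eval2_db_one del: bideriv_ext_var)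
  next
    fix a b i j
    assume prod: "p = var (a * b) i j - (\<Sum>m\<in>UNIV. var a i m * var b m j)"
    have "cls (\<Sum>m\<in>UNIV. var a i m * poly_bracket (var b m j) (var c k l)
            + var b m j * poly_bracket (var a i m) (var c k l))
      = (\<Oplus>m\<in>UNIV. entry a (i, m) \<otimes> eval2 w (m, j) (db b c) \<oplus> entry b (m, j) \<otimes> eval2 w (i, m) (db a c))"
      by (simp add: entry_class bracket_var[symmetric] rep_mult rep_add rep_finsum del: bideriv_ext_var)
    also have "\<dots> = (\<Oplus>m\<in>UNIV. entry a (i, m) \<otimes> eval2 w (m, j) (db b c))
        \<oplus> (\<Oplus>m\<in>UNIV. entry b (m, j) \<otimes> eval2 w (i, m) (db a c))"
      by (rule A.finsum_addf) auto
    also have "\<dots> = cls (poly_bracket (var (a * b) i j) (var c k l))"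
      unfolding bracket_var by (rule eval2_db_mult_left[symmetric])
    finally have "cls (poly_bracket (var (a * b) i j) (var c k l))
      = cls (\<Sum>m\<in>UNIV. var a i m * poly_bracket (var b m j) (var c k l)
            + var b m j * poly_bracket (var a i m) (var c k l))" ..
    then show ?thesis
      by (simp add: prod bideriv_ext_diff_left bideriv_ext_sum_left bideriv_ext_mult_left
          cls_eq_zero_iff rep_class_eq_iff del: bideriv_ext_var)
  qed
  then show ?thesis by (simp add: cls_eq_zero_iff)
qed

text \<open>
  The elements of the ideal whose brackets with all polynomials stay in the ideal form an ideal
  by the Leibniz rule.  It contains the relations, because bracketing with a fixed relation is a
  derivation and it suffices to test variables.
\<close>

lemma poly_bracket_ideal_left:
  assumes p: "p \<in> rep_ideal scale"
  shows "poly_bracket p q \<in> rep_ideal scale"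
proof -
  let ?J = "{p \<in> rep_ideal scale. \<forall>q. poly_bracket p q \<in> rep_ideal scale}"
  have "rep_ideal scale \<subseteq> ?J"
  proof (rule rep_ideal_minimal)
    show "rep_relations scale \<subseteq> ?J"
    proof
      fix p :: "('k, 'a, 'n) rep_poly" assume p: "p \<in> rep_relations scale"
      have "poly_bracket p q \<in> rep_ideal scale" for q
        by (induction q rule: rep_poly_induct)
          (simp_all add: rep_ideal_0 poly_bracket_relation_var[OF p] bideriv_ext_add_right
            bideriv_ext_mult_right rep_ideal_add rep_ideal_mult)
      then show "p \<in> ?J" using p rep_relations_subset[of scale] by blast
    qed
    fix p q :: "('k, 'a, 'n) rep_poly" assume p: "p \<in> ?J"
    have "p * poly_bracket q r \<in> rep_ideal scale" for r
      using p rep_ideal_mult[of p scale "poly_bracket q r"] by (simp add: mult.commute)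
    then show "q * p \<in> ?J"
      using p by (simp add: bideriv_ext_mult_left rep_ideal_add rep_ideal_mult)
  qed (simp_all add: rep_ideal_0 bideriv_ext_add_left rep_ideal_add)
  with p show ?thesis by blast
qed

lemma poly_bracket_antisym: "poly_bracket p q + poly_bracket q p \<in> rep_ideal scale"
proof (induction p rule: rep_poly_induct)
  case (const c)
  show ?case by (simp add: rep_ideal_0)
next
  case (var a i j)
  show ?case
  proof (induction q rule: rep_poly_induct)
    case (const c)
    show ?case by (simp add: rep_ideal_0)
  next
    case (var b k l)
    have "cls (poly_bracket (var a i j) (var b k l)) \<oplus> cls (poly_bracket (var b k l) (var a i j)) = \<zero>"
      by (simp add: cls_entry_bracket eval2_db_antisym[of "(k, l)" "(i, j)" a b] A.l_neg)
    then show ?case by (simp only: rep_add cls_eq_zero_iff)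
  next
    case (add p q)
    from rep_ideal_add[OF this] show ?case
      by (simp add: bideriv_ext_add_left bideriv_ext_add_right algebra_simps)
  next
    case (mult p q)
    from rep_ideal_add[OF rep_ideal_mult[OF this(2), of p] rep_ideal_mult[OF this(1), of q]]
    show ?case by (simp add: bideriv_ext_mult_left bideriv_ext_mult_right algebra_simps)
  qed
next
  case (add p p')
  from rep_ideal_add[OF this] show ?case
    by (simp add: bideriv_ext_add_left bideriv_ext_add_right algebra_simps)
next
  case (mult p p')
  from rep_ideal_add[OF rep_ideal_mult[OF this(2), of p] rep_ideal_mult[OF this(1), of p']]
  show ?case by (simp add: bideriv_ext_mult_left bideriv_ext_mult_right algebra_simps)
qed

text \<open>
  In the second argument the ideal is preserved because the bracket is antisymmetric modulo the
  ideal.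
\<close>

lemma poly_bracket_cong:
  assumes "cls p = cls p'" "cls q = cls q'"
  shows "cls (poly_bracket p q) = cls (poly_bracket p' q')"
proof -
  have "poly_bracket (p - p') q \<in> rep_ideal scale" "poly_bracket (q - q') p' \<in> rep_ideal scale"
    using assms by (simp_all add: rep_class_eq_iff poly_bracket_ideal_left)
  moreover have "poly_bracket p' (q - q') + poly_bracket (q - q') p' \<in> rep_ideal scale"
    by (rule poly_bracket_antisym)
  ultimately have "poly_bracket (p - p') q
      + ((poly_bracket p' (q - q') + poly_bracket (q - q') p') - poly_bracket (q - q') p') \<in> rep_ideal scale"
    by (intro rep_ideal_add[of "poly_bracket (p - p') q"] rep_ideal_diff)
  then show ?thesis
    by (simp add: rep_class_eq_iff bideriv_ext_diff_left bideriv_ext_diff_right)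
qed

definition rep_bracket ::
    "('k, 'a, 'n) rep_poly set \<Rightarrow> ('k, 'a, 'n) rep_poly set \<Rightarrow> ('k, 'a, 'n) rep_poly set" where
  "rep_bracket = (\<lambda>f\<in>carrier R. \<lambda>g\<in>carrier R.
     cls (poly_bracket (SOME p. cls p = f) (SOME q. cls q = g)))"

lemma rep_bracket_cls: "rep_bracket (cls p) (cls q) = cls (poly_bracket p q)"
proof -
  have "cls (poly_bracket (SOME p'. cls p' = cls p) (SOME q'. cls q' = cls q)) = cls (poly_bracket p q)"
    by (rule poly_bracket_cong;
        rule someI[where P = "\<lambda>p'. cls p' = cls p" for p, OF refl])
  then show ?thesis
    by (simp add: rep_bracket_def)
qed

lemma antisymmetric_biderivation_rep_bracket: "antisymmetric_biderivation R rep_bracket"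
proof (intro antisymmetric_biderivation.intro algebra_rep antisymmetric_biderivation_axioms.intro)
  show "rep_bracket \<in> carrier R \<rightarrow>\<^sub>E carrier R \<rightarrow>\<^sub>E carrier R"
    by (auto simp: rep_bracket_def)
  fix f g assume "f \<in> carrier R" "g \<in> carrier R"
  then obtain p q where pq: "f = cls p" "g = cls q"
    by (elim rep_carrierE)
  show "rep_bracket f g = \<ominus> rep_bracket g f"
    using poly_bracket_antisym[of p q]
    by (simp add: pq rep_bracket_cls rep_uminus rep_class_eq_iff)
qed (elim rep_carrierE; simp add: rep_bracket_cls cls_simps bideriv_ext_add_left bideriv_ext_add_right
      bideriv_ext_mult_left bideriv_ext_mult_right mult.commute)+

lemma rep_bracket_entry: "rep_bracket (entry a u) (entry b v) = eval2 v u (db a b)"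
  by (cases u; cases v) (simp add: entry_class rep_bracket_cls cls_entry_bracket)

end

section \<open>The Jacobi identity\<close>

context double_bracket_rep
begin

lemma multilinear_bracket_L:
  "multilinear_map scale 2 (tensor_power scale 3) (\<lambda>xs. tensor_append scale (db a (xs ! 0)) (xs ! 1))"
  by (rule multilinear_map2I)
    (simp_all add: db_add_right db_scale_right db_closed module_map_closed[OF tensor_append_map]
      module_map_add[OF tensor_append_map] module_map_smult[OF tensor_append_map]
      tensor_append_add tensor_append_scale)

lemma bracket_L_map: "module_map (tensor_power scale 2) (tensor_power scale 3) (bracket_L scale db a)"
  unfolding bracket_L_def
  by (rule tensor_lift_module_map[OF module_tensor_power multilinear_bracket_L])

lemma bracket_L_pure:
  "bracket_L scale db a (pure_tensor scale [x, y]) = tensor_append scale (db a x) y"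
  unfolding bracket_L_def
  by (subst tensor_lift_pure[OF module_tensor_power multilinear_bracket_L]) simp_all

lemma bracket_L_closed: "bracket_L scale db a (db b c) \<in> carrier (tensor_power scale 3)"
  by (rule module_map_closed[OF bracket_L_map db_closed])

text \<open>
  The Leibniz rule on \<open>x\<^sub>v y\<^sub>w\<close>: the summand containing \<open>{a\<^sub>u, x\<^sub>v}\<close> comes from bracketing with the first leg,
  the one containing \<open>{a\<^sub>u, y\<^sub>w}\<close> from bracketing with the second leg, which is the first leg of the
  opposite tensor.
\<close>

lemma bracket_entry_eval2:
  assumes B: "antisymmetric_biderivation R B"
    and B_entry: "\<And>b v. B (entry a u) (entry b v) = eval2 v u (db a b)"
    and d: "d \<in> carrier (tensor_power scale 2)"
  shows "B (entry a u) (eval2 v w d) = eval3 v u w (bracket_L scale db a d)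
    \<oplus> eval3 w u v (bracket_L scale db a (tensor_opposite scale d))"
proof -
  interpret B: antisymmetric_biderivation R B by (rule B)
  show ?thesis
  proof (rule module_map_eq_if_eq_on_pure[OF module_rep _ _ _ d])
    show "module_map (tensor_power scale 2) R (\<lambda>d. B (entry a u) (eval2 v w d))"
      by (rule module_map_comp[OF eval2_map derivation_map[OF B.derivation_bracket_right]]) simp
    show "module_map (tensor_power scale 2) R (\<lambda>d. eval3 v u w (bracket_L scale db a d)
        \<oplus> eval3 w u v (bracket_L scale db a (tensor_opposite scale d)))"
      by (rule module_map_plus[OF module_rep module_map_comp[OF bracket_L_map eval3_map]
            module_map_comp[OF module_map_comp[OF tensor_opposite_map bracket_L_map] eval3_map]])
    fix xs :: "'a list" assume "length xs = 2"
    then obtain x y where xs: "xs = [x, y]" using list2_cases by blast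
    have "B (entry a u) (entry x v \<otimes> entry y w)
        = entry x v \<otimes> eval2 w u (db a y) \<oplus> eval2 v u (db a x) \<otimes> entry y w"
      by (simp add: B.bracket_mult_right B_entry)
    also have "\<dots> = eval2 v u (db a x) \<otimes> entry y w \<oplus> eval2 w u (db a y) \<otimes> entry x v"
      by (simp add: A.m_comm A.a_comm)
    finally show "B (entry a u) (eval2 v w (pure_tensor scale xs))
        = eval3 v u w (bracket_L scale db a (pure_tensor scale xs))
          \<oplus> eval3 w u v (bracket_L scale db a (tensor_opposite scale (pure_tensor scale xs)))"
      by (simp add: xs eval2_pure tensor_opposite_pure bracket_L_pure eval3_append db_closed)
  qed
qed

text \<open>
  The opposite of \<open>\<lbrace>b, c\<rbrace>\<close> is \<open>- \<lbrace>c, b\<rbrace>\<close>, which turns the second summand into a bracket with \<open>\<lbrace>c, b\<rbrace>\<close>.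
\<close>

lemma double_bracket_entry:
  assumes B: "antisymmetric_biderivation R B"
    and B_entry: "\<And>a u b v. B (entry a u) (entry b v) = eval2 v u (db a b)"
  shows "B (entry a u) (B (entry b v) (entry c w)) =
    eval3 w u v (bracket_L scale db a (db b c)) \<oplus> \<ominus> eval3 v u w (bracket_L scale db a (db c b))"
proof -
  have "eval3 v u w (bracket_L scale db a (tensor_opposite scale (db b c)))
      = \<ominus> eval3 v u w (bracket_L scale db a (db c b))"
    unfolding tensor_opposite_db
    by (rule module_map_uminus[OF module_tensor_power module_rep
          module_map_comp[OF bracket_L_map eval3_map] db_closed])
  then show ?thesis
    unfolding B_entry bracket_entry_eval2[OF B B_entry db_closed] by simp
qed

lemma eval3_double_jacobiator:
  "double_jacobiator scale db a b c \<in> carrier (tensor_power scale 3)"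
  "eval3 u v w (double_jacobiator scale db a b c) = eval3 u v w (bracket_L scale db a (db b c))
    \<oplus> eval3 v w u (bracket_L scale db b (db c a)) \<oplus> eval3 w u v (bracket_L scale db c (db a b))"
proof -
  interpret T: Module.module scalars "tensor_power scale 3" by (rule module_tensor_power)
  have closed: "bracket_L scale db a (db b c) \<in> carrier (tensor_power scale 3)"
    "tensor_permute scale 3 (cycle_of_list [0, 1, 2]) (bracket_L scale db b (db c a))
      \<in> carrier (tensor_power scale 3)"
    "tensor_permute scale 3 (cycle_of_list [0, 2, 1]) (bracket_L scale db c (db a b))
      \<in> carrier (tensor_power scale 3)"
    using bracket_L_closed
      module_map_closed[OF tensor_permute_rearrange(1)[OF multilinear_permuted(1) permute_cycles(1)]]
      module_map_closed[OF tensor_permute_rearrange(1)[OF multilinear_permuted(2) permute_cycles(2)]]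
    by blast+
  show "double_jacobiator scale db a b c \<in> carrier (tensor_power scale 3)"
    unfolding double_jacobiator_def by (intro T.M.a_closed closed)
  show "eval3 u v w (double_jacobiator scale db a b c) = eval3 u v w (bracket_L scale db a (db b c))
    \<oplus> eval3 v w u (bracket_L scale db b (db c a)) \<oplus> eval3 w u v (bracket_L scale db c (db a b))"
    unfolding double_jacobiator_def
    by (simp only: module_map_add[OF eval3_map] closed T.M.a_closed eval3_permute[OF bracket_L_closed])
qed

lemma eval3_weak_double_jacobiator:
  "eval3 w u v (weak_double_jacobiator scale db a b c) =
    eval3 w u v (double_jacobiator scale db a b c) \<oplus> \<ominus> eval3 u w v (double_jacobiator scale db c b a)"
proof -
  interpret T: Module.module scalars "tensor_power scale 3" by (rule module_tensor_power)
  note closed = eval3_double_jacobiator(1)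
    module_map_closed[OF tensor_permute_rearrange(1)[OF multilinear_permuted(3) permute_cycles(3)]
      eval3_double_jacobiator(1)]
  show ?thesis
    unfolding weak_double_jacobiator_def a_minus_def
    by (simp only: module_map_add[OF eval3_map] closed T.M.a_inv_closed eval3_permute[OF closed(1)]
        module_map_uminus[OF module_tensor_power module_rep eval3_map])
qed

lemma regroup_jacobi_terms:
  assumes "X \<in> carrier R" "X' \<in> carrier R" "Y \<in> carrier R" "Y' \<in> carrier R" "Z \<in> carrier R" "Z' \<in> carrier R"
  shows "(X \<oplus> \<ominus> X') \<oplus> (Y \<oplus> \<ominus> Y') \<oplus> (Z \<oplus> \<ominus> Z') = (X \<oplus> Y \<oplus> Z) \<oplus> \<ominus> (Z' \<oplus> Y' \<oplus> X')"
  using assms by (elim rep_carrierE) (simp add: cls_simps rep_uminus algebra_simps)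

text \<open>
  This is where the weak double Jacobiator arises: of the six terms, the three positive ones form
  the double Jacobiator of \<open>a, b, c\<close>, and the three negative ones that of \<open>c, b, a\<close> with the first
  two positions exchanged.
\<close>

lemma jacobi_entries:
  assumes B: "antisymmetric_biderivation R B"
    and B_entry: "\<And>a u b v. B (entry a u) (entry b v) = eval2 v u (db a b)"
  shows "B (entry a u) (B (entry b v) (entry c w)) \<oplus> B (entry b v) (B (entry c w) (entry a u))
      \<oplus> B (entry c w) (B (entry a u) (entry b v))
    = eval3 w u v (weak_double_jacobiator scale db a b c)"
  unfolding double_bracket_entry[OF B B_entry] eval3_weak_double_jacobiator eval3_double_jacobiator(2)
  by (rule regroup_jacobi_terms; rule eval3_closed; rule bracket_L_closed)

section \<open>Trace functions\<close>

definition trace :: "'a \<Rightarrow> ('k, 'a, 'n) rep_poly set" where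
  "trace a = (\<Oplus>i\<in>UNIV. entry a (i, i))"

lemma trace_closed [simp]: "trace a \<in> carrier R"
  by (simp add: trace_def Pi_def)

abbreviation traces :: "('k, 'a, 'n) rep_poly set set" where
  "traces \<equiv> trace_ring scale"

lemma traces_hull: "traces = is_subalgebra R hull range trace"
  by (auto simp: trace_ring_def R_def[symmetric] trace_def[abs_def] entry_def full_SetCompr_eq)

lemma subalgebra_traces: "is_subalgebra R traces"
proof -
  let ?S = "{T. is_subalgebra R T \<and> range trace \<subseteq> T}"
  have carrier: "carrier R \<in> ?S"
    using A.carrier_is_subring by (auto simp: is_subalgebra_def)
  have "subring (\<Inter>?S) R"
    using carrier by (intro A.subring_Inter) (auto simp: is_subalgebra_def)
  then show ?thesis
    unfolding traces_hull hull_def by (auto simp: is_subalgebra_def)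
qed

lemma subring_traces: "subring traces R"
  using subalgebra_traces by (simp add: is_subalgebra_def)

lemmas traces_closed = subringE(2,3,5,6,7)[OF subring_traces]

lemma traces_subset: "f \<in> traces \<Longrightarrow> f \<in> carrier R"
  using subringE(1)[OF subring_traces] by blast

lemma traces_smult: "f \<in> traces \<Longrightarrow> c \<odot> f \<in> traces"
  using subalgebra_traces by (simp add: is_subalgebra_def)

lemma trace_in_traces: "trace a \<in> traces"
  unfolding traces_hull by (rule hull_inc) simp

text \<open>
  The elements of the trace ring that \<open>D\<close> maps into the trace ring form a subalgebra.
\<close>

lemma derivation_preserves_traces:
  assumes D: "derivation R D" and tr: "\<And>a. D (trace a) \<in> traces" and f: "f \<in> traces"
  shows "D f \<in> traces"
proof -
  let ?S = "{f \<in> traces. D f \<in> traces}"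
  note D_map = derivation_map[OF D]
  have "subring ?S R"
  proof (rule A.subringI)
    show "\<one> \<in> ?S"
      by (simp add: derivation_one[OF D] traces_closed)
    fix f assume f: "f \<in> ?S"
    then show "\<ominus> f \<in> ?S"
      by (simp add: traces_closed module_map_uminus[OF module_rep module_rep D_map] traces_subset)
    fix g assume g: "g \<in> ?S"
    show "f \<otimes> g \<in> ?S" "f \<oplus> g \<in> ?S"
      using f g by (simp_all add: traces_closed traces_subset derivation_mult[OF D] module_map_add[OF D_map])
  qed (auto intro: traces_subset)
  then have "is_subalgebra R ?S"
    by (auto simp: is_subalgebra_def traces_smult module_map_smult[OF D_map] traces_subset)
  then have "is_subalgebra R hull range trace \<subseteq> ?S"
    by (intro hull_minimal) (auto simp: trace_in_traces tr)
  then show ?thesis using f traces_hull by blast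
qed

text \<open>
  On a pure tensor \<open>x \<otimes> y\<close> the double sum is \<open>tr x \<cdot> tr y\<close>.
\<close>

lemma trace_eval2_in_traces:
  assumes "d \<in> carrier (tensor_power scale 2)"
  shows "(\<Oplus>i\<in>UNIV. \<Oplus>k\<in>UNIV. eval2 (k, k) (i, i) d) \<in> traces"
  using assms
proof (induction d rule: tensor_induct)
  have map: "module_map (tensor_power scale 2) R (\<lambda>d. \<Oplus>i\<in>UNIV. \<Oplus>k\<in>UNIV. eval2 (k, k) (i, i) d)"
    by (rule module_map_finsum[OF module_rep module_map_finsum[OF module_rep eval2_map]])
  {
    case zero
    show ?case
      using module_map_zero[OF module_tensor_power module_rep map] by (simp add: traces_closed)
  next
    case (pure c xs)
    then obtain x y where xs: "xs = [x, y]" using list2_cases by blast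
    have inner: "(\<Oplus>k\<in>UNIV. entry x (k, k) \<otimes> entry y (i, i)) = trace x \<otimes> entry y (i, i)" for i
      unfolding trace_def by (rule A.finsum_ldistr[symmetric]) auto
    have "(\<Oplus>i\<in>UNIV. trace x \<otimes> entry y (i, i)) = trace x \<otimes> trace y"
      unfolding trace_def[of y] by (rule A.finsum_rdistr[symmetric]) auto
    then have "(\<Oplus>i\<in>UNIV. \<Oplus>k\<in>UNIV. eval2 (k, k) (i, i) (pure_tensor scale xs)) = trace x \<otimes> trace y"
      by (simp only: xs eval2_pure inner)
    then show ?case
      using module_map_smult[OF map pure_tensor_closed[OF pure], of c]
      by (simp only: traces_smult traces_closed trace_in_traces)
  next
    case (add x y)
    then show ?case
      using module_map_add[OF map add(1,2)] by (simp only: traces_closed)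
  }
qed

text \<open>
  For a fixed trace on the right, and then for a fixed element of the trace ring on the left, the
  bracket is a derivation; in each case it suffices to test traces.
\<close>

lemma bracket_preserves_traces:
  assumes B: "antisymmetric_biderivation R B"
    and B_entry: "\<And>a u b v. B (entry a u) (entry b v) = eval2 v u (db a b)"
    and f: "f \<in> traces" and g: "g \<in> traces"
  shows "B f g \<in> traces"
proof -
  interpret B: antisymmetric_biderivation R B by (rule B)
  have trace_trace: "B (trace a) (trace b) \<in> traces" for a b
  proof -
    have "B (trace a) (trace b) = (\<Oplus>i\<in>UNIV. B (entry a (i, i)) (trace b))"
      unfolding trace_def[of a]
      by (rule module_map_finsum_apply[OF module_rep module_rep
            derivation_map[OF B.derivation_bracket_left[OF trace_closed]]]) auto
    also have "\<dots> = (\<Oplus>i\<in>UNIV. \<Oplus>k\<in>UNIV. eval2 (k, k) (i, i) (db a b))"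
    proof -
      have "B (entry a (i, i)) (trace b) = (\<Oplus>k\<in>UNIV. B (entry a (i, i)) (entry b (k, k)))" for i
        unfolding trace_def
        by (rule module_map_finsum_apply[OF module_rep module_rep
              derivation_map[OF B.derivation_bracket_right[OF entry_closed]]]) auto
      then show ?thesis by (simp only: B_entry)
    qed
    finally show ?thesis
      using trace_eval2_in_traces[OF db_closed] by simp
  qed
  have trace_right: "B f (trace b) \<in> traces" if "f \<in> traces" for f b
    by (rule derivation_preserves_traces[OF B.derivation_bracket_left[OF trace_closed] trace_trace that])
  show ?thesis
    by (rule derivation_preserves_traces[OF B.derivation_bracket_right[OF traces_subset[OF f]]
          trace_right[OF f] g])
qed

end

text \<open>
  The axioms are inherited from the ambient algebra.  Negation is defined through the carrier, so
  its agreement with the ambient one requires an argument.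
\<close>

lemma poisson_bracket_restrict:
  fixes R :: "('k::field, 'r, 'z) module_scheme"
  assumes B: "poisson_bracket R B" and S: "is_subalgebra R S"
    and BS: "\<And>f g. f \<in> S \<Longrightarrow> g \<in> S \<Longrightarrow> B f g \<in> S"
  shows "poisson_bracket (R\<lparr>carrier := S\<rparr>) (\<lambda>f\<in>S. \<lambda>g\<in>S. B f g)"
proof -
  interpret B: poisson_bracket R B by (rule B)
  have cring: "cring R" by (rule B.M_cring)
  have sub: "subring S R" using S by (simp add: is_subalgebra_def)
  note S_closed = subringE(2,3,5,6,7)[OF sub]
  have S_carrier: "f \<in> S \<Longrightarrow> f \<in> carrier R" for f
    using subringE(1)[OF sub] by blast
  have S_smult: "f \<in> S \<Longrightarrow> c \<odot>\<^bsub>R\<^esub> f \<in> S" for c f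
    using S by (simp add: is_subalgebra_def)
  have cring_S: "cring (R\<lparr>carrier := S\<rparr>)"
    using ring.subcring_iff[OF cring.axioms(1)[OF cring] subringE(1)[OF sub]]
      cring.subcringI'[OF cring sub] by blast
  have uminus: "\<ominus>\<^bsub>R\<lparr>carrier := S\<rparr>\<^esub> f = \<ominus>\<^bsub>R\<^esub> f" if "f \<in> S" for f
  proof -
    interpret S: cring "R\<lparr>carrier := S\<rparr>" by (rule cring_S)
    have "\<ominus>\<^bsub>R\<^esub> f \<oplus>\<^bsub>R\<^esub> f = \<zero>\<^bsub>R\<^esub>"
      by (rule abelian_group.l_neg[OF _ S_carrier[OF that]]) (rule B.M.abelian_group_axioms)
    then show ?thesis
      using S.minus_equality[of "\<ominus>\<^bsub>R\<^esub> f" f] that by (simp add: S_closed)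
  qed
  have algebra: "algebra scalars (R\<lparr>carrier := S\<rparr>)"
    by (rule algebraI[OF B.R_cring cring_S])
      (use B.smult_l_distr B.smult_r_distr B.smult_assoc1 B.smult_assoc2 B.smult_one
        in \<open>simp_all add: S_smult S_carrier\<close>)
  show ?thesis
  proof (intro poisson_bracket.intro antisymmetric_biderivation.intro algebra
      antisymmetric_biderivation_axioms.intro poisson_bracket_axioms.intro)
    show "(\<lambda>f\<in>S. \<lambda>g\<in>S. B f g) \<in> carrier (R\<lparr>carrier := S\<rparr>) \<rightarrow>\<^sub>E
        carrier (R\<lparr>carrier := S\<rparr>) \<rightarrow>\<^sub>E carrier (R\<lparr>carrier := S\<rparr>)"
      by (auto simp: BS)
  next
    fix f g assume "f \<in> carrier (R\<lparr>carrier := S\<rparr>)" "g \<in> carrier (R\<lparr>carrier := S\<rparr>)"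
    then have "f \<in> S" "g \<in> S" by simp_all
    then show "(\<lambda>f\<in>S. \<lambda>g\<in>S. B f g) f g = \<ominus>\<^bsub>R\<lparr>carrier := S\<rparr>\<^esub> (\<lambda>f\<in>S. \<lambda>g\<in>S. B f g) g f"
      using B.bracket_antisym[of f g] by (simp add: uminus BS S_carrier)
  next
    fix f g h
    assume "f \<in> carrier (R\<lparr>carrier := S\<rparr>)" "g \<in> carrier (R\<lparr>carrier := S\<rparr>)"
      "h \<in> carrier (R\<lparr>carrier := S\<rparr>)"
    then have "f \<in> S" "g \<in> S" "h \<in> S" by simp_all
    then show "(\<lambda>f\<in>S. \<lambda>g\<in>S. B f g) f ((\<lambda>f\<in>S. \<lambda>g\<in>S. B f g) g h)
        \<oplus>\<^bsub>R\<lparr>carrier := S\<rparr>\<^esub> (\<lambda>f\<in>S. \<lambda>g\<in>S. B f g) g ((\<lambda>f\<in>S. \<lambda>g\<in>S. B f g) h f)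
        \<oplus>\<^bsub>R\<lparr>carrier := S\<rparr>\<^esub> (\<lambda>f\<in>S. \<lambda>g\<in>S. B f g) h ((\<lambda>f\<in>S. \<lambda>g\<in>S. B f g) f g)
        = \<zero>\<^bsub>R\<lparr>carrier := S\<rparr>\<^esub>"
      using B.jacobi[of f g h] by (simp add: BS S_carrier)
  qed (simp_all add: S_closed S_smult S_carrier B.bracket_add_left B.bracket_add_right
      B.bracket_smult_left B.bracket_smult_right B.bracket_mult_left B.bracket_mult_right)
qed

theorem theorem4p14:
  fixes scale :: "'k::field_char_0 \<Rightarrow> 'a::{ring, monoid_mult} \<Rightarrow> 'a"
    and db :: "'a \<Rightarrow> 'a \<Rightarrow> ('a list \<Rightarrow>\<^sub>0 'k) set"
  assumes fin_gen: "finitely_generated_algebra scale"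
    and weak_poisson: "weak_poisson_double_bracket scale db"
  shows "(\<exists>!B :: ('k, 'a, 'n::finite) rep_poly set \<Rightarrow> ('k, 'a, 'n) rep_poly set
                  \<Rightarrow> ('k, 'a, 'n) rep_poly set. induced_bracket scale db B) \<and>
         (\<forall>B :: ('k, 'a, 'n) rep_poly set \<Rightarrow> ('k, 'a, 'n) rep_poly set
                  \<Rightarrow> ('k, 'a, 'n) rep_poly set. induced_bracket scale db B \<longrightarrow>
           poisson_bracket (rep_algebra scale) B \<and>
           (\<forall>f \<in> trace_ring scale. \<forall>g \<in> trace_ring scale. B f g \<in> trace_ring scale) \<and>
           poisson_bracket ((rep_algebra scale)\<lparr>carrier := trace_ring scale\<rparr>)
             (\<lambda>f \<in> trace_ring scale. \<lambda>g \<in> trace_ring scale. B f g))"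
proof -
  interpret weak_poisson_double_bracket scale db by (rule weak_poisson)
  define R where "R = (rep_algebra scale :: ('k, ('k, 'a, 'n) rep_poly set) module)"
  interpret double_bracket_rep scale R db
    by unfold_locales (rule R_def)
  have induced_iff: "induced_bracket scale db B \<longleftrightarrow> antisymmetric_biderivation R B \<and>
      (\<forall>a b u v. B (entry a u) (entry b v) = eval2 v u (db a b))"
    for B :: "('k, 'a, 'n) rep_poly set \<Rightarrow> ('k, 'a, 'n) rep_poly set \<Rightarrow> ('k, 'a, 'n) rep_poly set"
    by (simp add: induced_bracket_def entry_def eval2_def R_def[symmetric])
  have unique: "B = B'" if "induced_bracket scale db B" "induced_bracket scale db B'"
    for B B' :: "('k, 'a, 'n) rep_poly set \<Rightarrow> ('k, 'a, 'n) rep_poly set \<Rightarrow> ('k, 'a, 'n) rep_poly set"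
  proof (rule biderivation_eqI)
    show "antisymmetric_biderivation R B" "antisymmetric_biderivation R B'"
      using that by (simp_all only: induced_iff)
    show "B (entry a u) (entry b v) = B' (entry a u) (entry b v)" for a u b v
      using that by (simp only: induced_iff)
  qed
  have "induced_bracket scale db rep_bracket"
    by (simp add: induced_iff antisymmetric_biderivation_rep_bracket rep_bracket_entry)
  then have "\<exists>!B :: ('k, 'a, 'n) rep_poly set \<Rightarrow> ('k, 'a, 'n) rep_poly set
      \<Rightarrow> ('k, 'a, 'n) rep_poly set. induced_bracket scale db B"
    using unique by (intro ex1I[of _ rep_bracket]) auto
  moreover have "poisson_bracket R B \<and> (\<forall>f\<in>traces. \<forall>g\<in>traces. B f g \<in> traces) \<and>
      poisson_bracket (R\<lparr>carrier := traces\<rparr>) (\<lambda>f\<in>traces. \<lambda>g\<in>traces. B f g)"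
    if "induced_bracket scale db B"
    for B :: "('k, 'a, 'n) rep_poly set \<Rightarrow> ('k, 'a, 'n) rep_poly set \<Rightarrow> ('k, 'a, 'n) rep_poly set"
  proof -
    from that have B: "antisymmetric_biderivation R B"
      and B_entry: "\<And>a u b v. B (entry a u) (entry b v) = eval2 v u (db a b)"
      using that unfolding induced_iff by blast+
    have poisson: "poisson_bracket R B"
      by (rule poisson_if_jacobi_on_entries[OF B])
        (simp only: jacobi_entries[OF B B_entry] weak_jacobi
          module_map_zero[OF module_tensor_power module_rep eval3_map])
    have closed: "B f g \<in> traces" if "f \<in> traces" "g \<in> traces" for f g
      by (rule bracket_preserves_traces[OF B B_entry that])
    show ?thesis
      using poisson closed poisson_bracket_restrict[OF poisson subalgebra_traces closed] by blast
  qed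
  ultimately show ?thesis
    unfolding R_def by blast
qed

end
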